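(* Suppose there exist constants $\bar\Delta,\sigma>0$ such that for all $t\ge0$: (i) with $\bar\Delta_t=\|\bar x_t-\bar x_{t+1}\|$, $\mathbb{E}[\exp(\lambda\bar\Delta_t^2)\mid\mathcal{F}_t]\le\exp(\lambda\bar\Delta^2)$ for all $0\le\lambda\le\bar\Delta^{-2}$; (ii) $\mathbb{P}\{\|z_t\|\ge\tau\mid\mathcal{F}_t\}\le2\exp(-2\tau^2/\sigma^2)$ for all $\tau>0$. Suppose $\bar\Delta/\sigma<\sqrt{\bar\mu/(16L^3)}$. Set $\bar\eta_\star=(2\bar\Delta^2/(\bar\mu\sigma^2))^{1/3}$ and $\bar{\mathcal{E}}=(\bar\Delta\sigma^2/\bar\mu^2)^{2/3}$, and let $D\ge\|x_0-\bar x_0\|^2$. Run the decision-dependent proximal stochastic gradient method in epochs $k=0,\dots,K-1$: set $X_0=x_0$ and let $X_{k+1}$ be the output of the method started at $X_k$ and run for $T_k$ steps with constant step size $\eta_k$, where $$K=1+\left\lceil\log_2\left(\frac1L\left(\frac{\sigma^2\bar\mu}{\bar\Delta^2}\right)^{1/3}\right)\right\rceil,\qquad \eta_0=\frac1{2L},\qquad T_0=\left\lceil\frac{4L}{\bar\mu}\log\left(\frac{\bar\mu LD}{\sigma^2}\right)^+\right\rceil,$$ and, for all $k\ge1$, $$\eta_k=\frac{\eta_{k-1}+\bar\eta_\star}{2},\qquad T_k=\left\lceil\frac{2\log 12}{\bar\mu\eta_k}\right\rceil.$$ Then the time horizon $T=T_0+\cdots+T_{K-1}$ satisfies $$T\lesssim\frac{L}{\bar\mu}\log\left(\frac{\bar\mu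 LD}{\sigma^2}\right)^++\frac{\sigma^2}{\bar\mu^2\bar{\mathcal{E}}}\le\frac{L}{\bar\mu}\log\left(\frac{D}{\bar{\mathcal{E}}}\right)^++\frac{\sigma^2}{\bar\mu^2\bar{\mathcal{E}}},$$ and for any specified $\delta\in(0,1)$, the tracking error satisfies $$\|X_K-\bar X_K\|^2\lesssim\bar{\mathcal{E}}\log\left(\frac e\delta\right)$$ with probability at least $1-\delta$, where $\bar X_K:=\bar x_T$ is the minimizer of $\psi_T$.
   Context: Notation: $\mathbb{N}=\{0,1,2,\dots\}$; $\mathbb{R}^d$ carries the Euclidean inner product $\langle\cdot,\cdot\rangle$ and norm $\|\cdot\|$; $a^+=\max\{a,0\}$, and $\log(s)^+$ means $(\log s)^+$ (with $\log(0)^+=0$); $A\lesssim B$ means $A\le CB$ for an absolute numerical constant $C>0$ independent of all problem parameters. Problem family. For each $t\in\mathbb{N}$ and $x\in\mathbb{R}^d$, $f_{t,x}\colon\mathbb{R}^d\to\mathbb{R}$ is $\mu$-strongly convex and $C^1$-smooth with $L$-Lipschitz gradient, for common constants $\mu,L>0$; $\nabla f_{t,x}(u)$ denotes the gradient of $f_{t,x}(\cdot)$ at $u$. For each $t$, $r_t\colon\mathbb{R}^d\to\mathbb{R}\cup\{\infty\}$ is proper, closed, convex. Set $$\gamma:=\sup_{t\in\mathbb{N},\,u,x,y\in\mathbb{R}^d,\,x\ne y}\frac{\|\nabla f_{t,x}(u)-\nabla f_{t,y}(u)\|}{\|x-y\|},$$ and assume $\gamma<\mu$. Set $\bar\mu:=\mu-\gamma>0$.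 The functions may be random (the problem may evolve stochastically), with these conditions holding for every outcome with deterministic $\mu,L,\gamma$. Equilibria. For each $t$ there is a unique point $\bar x_t$ with $\bar x_t\in\operatorname{argmin}_{u\in\mathbb{R}^d}\{f_{t,\bar x_t}(u)+r_t(u)\}$. Set $\psi_t:=f_{t,\bar x_t}+r_t$; its minimizer is $\bar x_t$. Algorithm (decision-dependent proximal stochastic gradient method). At time $t$, with current iterate $x_t$ and step size $\eta>0$, a stochastic gradient $g_t$ (estimator of $\nabla f_{t,x_t}(x_t)$) is obtained and $$x_{t+1}=\operatorname{prox}_{\eta r_t}(x_t-\eta g_t)=\operatorname{argmin}_{u\in\mathbb{R}^d}\left\{r_t(u)+\tfrac{1}{2\eta}\|u-(x_t-\eta g_t)\|^2\right\}.$$ The gradient noise is $z_t:=\nabla f_{t,x_t}(x_t)-g_t$. When run in epochs, time continues across epochs: with $t_k=T_0+\cdots+T_{k-1}$ (and $t_0=0$), epoch $k$ uses the times $t=t_k,\dots,t_k+T_k-1$, starts at $x_{t_k}=X_k$, uses the constant step size $\eta_k$, and outputs $X_{k+1}=x_{t_{k+1}}$. Stochastic framework. There is a probability space $(\Omega,\mathcal{F},\mathbb{P})$ with filtration $(\mathcal{F}_t)_{t\ge0}$, $\mathcal{F}_0=\{\emptyset,\Omega\}$, such that for all $t\ge0$: $x_t,\bar x_t\colon\Omega\to\mathbb{R}^d$ are $\mathcal{F}_t$-measurable, and $z_t\colon\Omega\to\mathbb{R}^d$ is $\mathcal{F}_{t+1}$-measurable with $\mathbb{E}[z_t\mid\mathcal{F}_t]=0$.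 *)

theory Defs
  imports "HOL-Probability.Probability"
begin

section \<open>Convex analysis\<close>

definition gradient :: "('a::real_inner \<Rightarrow> real) \<Rightarrow> 'a \<Rightarrow> 'a" where
  "gradient f u = (THE D. GDERIV f u :> D)"

text \<open>Lipschitz continuity of the gradient makes \<open>f\<close> continuously differentiable.\<close>
definition smooth_with :: "real \<Rightarrow> ('a::real_inner \<Rightarrow> real) \<Rightarrow> bool" where
  "smooth_with L f \<longleftrightarrow>
     (\<forall>u. GDERIV f u :> gradient f u) \<and> L-lipschitz_on UNIV (gradient f)"

definition strongly_convex :: "real \<Rightarrow> ('a::real_inner \<Rightarrow> real) \<Rightarrow> bool" where
  "strongly_convex \<mu> f \<longleftrightarrow> convex_on UNIV (\<lambda>u. f u - \<mu> / 2 * (norm u)\<^sup>2)"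

text \<open>The library constant \<open>epigraph\<close> is restricted to real-valued functions.\<close>
definition ereal_epigraph :: "('a \<Rightarrow> ereal) \<Rightarrow> ('a \<times> real) set" where
  "ereal_epigraph r = {(u, c). r u \<le> ereal c}"

definition proper_closed_convex :: "('a::real_inner \<Rightarrow> ereal) \<Rightarrow> bool" where
  "proper_closed_convex r \<longleftrightarrow>
     (\<forall>u. r u \<noteq> -\<infinity>) \<and> (\<exists>u. r u \<noteq> \<infinity>) \<and>
     closed (ereal_epigraph r) \<and> convex (ereal_epigraph r)"

text \<open>The proximal point is characterised as a member of the argmin, which is a singleton
  whenever \<open>r\<close> is proper, closed and convex and \<open>\<eta> > 0\<close>.\<close>
definition is_prox :: "real \<Rightarrow> ('a::real_inner \<Rightarrow> ereal) \<Rightarrow> 'a \<Rightarrow> 'a \<Rightarrow> bool" where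
  "is_prox \<eta> r v p \<longleftrightarrow>
     is_arg_min (\<lambda>u. r u + ereal (1 / (2 * \<eta>) * (norm (u - v))\<^sup>2)) (\<lambda>_. True) p"

section \<open>Decision-dependent problems\<close>

text \<open>Throughout, \<open>f t \<omega> x u\<close> stands for $f_{t,x}(u)$ at the outcome \<open>\<omega>\<close>, and \<open>r t \<omega> u\<close> for $r_t(u)$.\<close>

text \<open>The supremum is taken in \<open>ereal\<close>, since a real supremum of an unbounded set is
  unspecified. It ranges over the outcomes as well, so that it is deterministic.\<close>
definition sensitivity ::
  "'w set \<Rightarrow> (nat \<Rightarrow> 'w \<Rightarrow> 'a::real_inner \<Rightarrow> 'a \<Rightarrow> real) \<Rightarrow> ereal" where
  "sensitivity \<Omega> f =
     (SUP (t, \<omega>, u, x, y) \<in> {(t, \<omega>, u, x, y). \<omega> \<in> \<Omega> \<and> x \<noteq> y}.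
        ereal (norm (gradient (f t \<omega> x) u - gradient (f t \<omega> y) u) / norm (x - y)))"

text \<open>The arguments are a family $x \mapsto f_x$ and a regularizer, at a fixed time and
  outcome. An equilibrium is unique as soon as $\gamma < \mu$.\<close>
definition is_equilibrium ::
  "('a::real_inner \<Rightarrow> 'a \<Rightarrow> real) \<Rightarrow> ('a \<Rightarrow> ereal) \<Rightarrow> 'a \<Rightarrow> bool" where
  "is_equilibrium fx rx e \<longleftrightarrow> is_arg_min (\<lambda>u. ereal (fx e u) + rx u) (\<lambda>_. True) e"

section \<open>Stochastic framework\<close>

text \<open>The library provides conditional expectations of real functions only.\<close>
definition vec_cond_exp ::
  "'w measure \<Rightarrow> 'w measure \<Rightarrow> ('w \<Rightarrow> 'a::euclidean_space) \<Rightarrow> 'w \<Rightarrow> 'a" where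
  "vec_cond_exp M G Z \<omega> = (\<Sum>b\<in>Basis. real_cond_exp M G (\<lambda>\<omega>'. Z \<omega>' \<bullet> b) \<omega> *\<^sub>R b)"

definition filtered_prob_space :: "'w measure \<Rightarrow> (nat \<Rightarrow> 'w measure) \<Rightarrow> bool" where
  "filtered_prob_space M F \<longleftrightarrow>
     prob_space M \<and> filtration (space M) F \<and> (\<forall>t. subalgebra M (F t)) \<and>
     sets (F 0) = {{}, space M}"

section \<open>The step-decay schedule\<close>

text \<open>In the following definitions \<open>m\<close> stands for $\bar\mu = \mu - \gamma$ and \<open>\<Delta>\<close> for $\bar\Delta$.\<close>

definition log_plus :: "real \<Rightarrow> real" where
  "log_plus s = (if s \<le> 0 then 0 else max (ln s) 0)"

definition eta_star :: "real \<Rightarrow> real \<Rightarrow> real \<Rightarrow> real" where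
  "eta_star m \<Delta> \<sigma> = (2 * \<Delta>\<^sup>2 / (m * \<sigma>\<^sup>2)) powr (1/3)"

definition err_star :: "real \<Rightarrow> real \<Rightarrow> real \<Rightarrow> real" where
  "err_star m \<Delta> \<sigma> = (\<Delta> * \<sigma>\<^sup>2 / m\<^sup>2) powr (2/3)"

definition num_epochs :: "real \<Rightarrow> real \<Rightarrow> real \<Rightarrow> real \<Rightarrow> nat" where
  "num_epochs m L \<Delta> \<sigma> =
     nat (1 + \<lceil>log 2 (1 / L * (\<sigma>\<^sup>2 * m / \<Delta>\<^sup>2) powr (1/3))\<rceil>)"

primrec epoch_step :: "real \<Rightarrow> real \<Rightarrow> real \<Rightarrow> real \<Rightarrow> nat \<Rightarrow> real" where
  "epoch_step m L \<Delta> \<sigma> 0 = 1 / (2 * L)"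
| "epoch_step m L \<Delta> \<sigma> (Suc k) = (epoch_step m L \<Delta> \<sigma> k + eta_star m \<Delta> \<sigma>) / 2"

definition epoch_length :: "real \<Rightarrow> real \<Rightarrow> real \<Rightarrow> real \<Rightarrow> real \<Rightarrow> nat \<Rightarrow> nat" where
  "epoch_length m L \<Delta> \<sigma> D k =
     (if k = 0 then nat \<lceil>4 * L / m * log_plus (m * L * D / \<sigma>\<^sup>2)\<rceil>
      else nat \<lceil>2 * ln 12 / (m * epoch_step m L \<Delta> \<sigma> k)\<rceil>)"

definition epoch_start :: "real \<Rightarrow> real \<Rightarrow> real \<Rightarrow> real \<Rightarrow> real \<Rightarrow> nat \<Rightarrow> nat" where
  "epoch_start m L \<Delta> \<sigma> D k = (\<Sum>j<k. epoch_length m L \<Delta> \<sigma> D j)"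

section \<open>The absolute constant\<close>

text \<open>The relation $A \lesssim B$ means $A \le C B$ for an absolute constant \<open>C\<close>. Type variables are
  quantified outside of any formula, so an existential quantifier over \<open>C\<close> inside a theorem would
  allow \<open>C\<close> to depend on the type of the decision variable, that is on the dimension, and on
  the type of outcomes. A fixed numeral rules this out; its value is generous and has no
  significance.\<close>
definition abs_const :: real where
  "abs_const = 1000"

end

theory Submission
  imports Defs
begin

text \<open>Write $v_t = x_t - \bar x_t$. Comparing the optimality conditions of the proximal step and
  of the equilibrium gives
  \[ \|v_{t+1}\|^2 \le (1 - \eta\bar\mu)\|v_t\|^2 + 2\eta\langle z_t, v_t\rangle
     + 2\eta^2\|z_t\|^2 + \tfrac{3}{2\eta\bar\mu}\bar\Delta_t^2, \]
  where the noise is paired only with the $\mathcal{F}_t$-measurable vector $v_t$. For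
  $\lambda \le \bar\mu/(32\eta\sigma^2)$ the sub-Gaussian cross term costs at most half of the
  contraction, so that
  \[ E \exp(\lambda\|v_{t+1}\|^2) \le \exp(\tfrac{15}{4}\lambda\eta^2\sigma^2)\,
     E \exp(\lambda(1 - \eta\bar\mu/2)\|v_t\|^2). \]
  Iterating this over an epoch preserves the invariant that the exponential moment of
  $\|v\|^2$ at $\lambda_k = \bar\mu/(32\eta_k\sigma^2)$ is at most $e$ after epoch $k$: the epoch
  contracts by the factor $12$ while $\lambda_k$ at most doubles. Markov's inequality after the last
  epoch gives the tail bound.\<close>

section \<open>One step of the method\<close>

text \<open>Per step, noise of order \<open>\<eta>^2 * \<sigma>^2\<close> competes with drift of
  order \<open>\<Delta>^2 / (\<eta> * m)\<close>. They balance when \<open>\<eta>^3\<close> is of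
  order \<open>\<Delta>^2 / (m * \<sigma>^2)\<close>, the origin of \<open>eta_star\<close>. The
  bound on \<open>\<Delta>bar / \<sigma>\<close> says exactly that \<open>eta_star\<close> lies
  below the initial step \<open>1 / (2 * L)\<close>. Hence the steps decrease towards
  \<open>eta_star\<close> from above, the drift is dominated by the noise in every epoch, and one
  moment parameter per epoch serves both. Two obstacles shape the argument. The new iterate depends
  on the current noise, so pairing the noise with the new error would destroy its centring; the
  difference is absorbed by the squared displacement of the step, half of which is left over because
  \<open>\<eta> * L \<le> 1 / 2\<close>. And the variance of the cross term grows with the squared
  error, which is unbounded; it has the same form as the contraction, which is why it can be paid
  for there, but only for small moment parameters.\<close>

lemma GDERIV_line:
  assumes "GDERIV f (p + s *\<^sub>R d) :> G"
  shows "((\<lambda>s. f (p + s *\<^sub>R d)) has_real_derivative d \<bullet> G) (at s)"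
proof -
  have "((\<lambda>s. p + s *\<^sub>R d) has_derivative (\<lambda>h. h *\<^sub>R d)) (at s)"
    by (auto intro!: derivative_eq_intros)
  from has_derivative_compose[OF this assms[unfolded gderiv_def]]
  have "((\<lambda>s. f (p + s *\<^sub>R d)) has_derivative (\<lambda>h. h *\<^sub>R d \<bullet> G)) (at s)" .
  then show ?thesis
    by (simp add: has_field_derivative_def mult_commute_abs)
qed

text \<open>Minimality is asked only to the right of 0: along a segment issuing from a minimizer, an
  extended-valued regularizer is controlled only between the two endpoints.\<close>

lemma DERIV_nonneg_at_right_minimum:
  fixes k :: "real \<Rightarrow> real"
  assumes "(k has_real_derivative D) (at 0)" and "\<And>s. 0 < s \<Longrightarrow> s \<le> 1 \<Longrightarrow> k 0 \<le> k s"
  shows "0 \<le> D"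
proof (rule ccontr)
  assume "\<not> 0 \<le> D"
  with DERIV_neg_dec_right[OF assms(1)] obtain e where
    e: "e > 0" "\<And>h. 0 < h \<Longrightarrow> h < e \<Longrightarrow> k h < k 0" by (auto simp: not_le)
  define s where "s = min 1 (e / 2)"
  have "0 < s" "s < e" "s \<le> 1" using e(1) by (auto simp: s_def min_def)
  with e(2)[of s] assms(2)[of s] show False by auto
qed

lemma convex_on_gradient_lower:
  assumes "convex_on UNIV h" and G: "GDERIV h u :> G"
  shows "h u + G \<bullet> (v - u) \<le> h v"
proof -
  \<comment> \<open>The chord minus the function vanishes at \<open>s = 0\<close> and is nonnegative
    up to \<open>s = 1\<close>, so its derivative at 0 is nonnegative.\<close>
  have "((\<lambda>s. s * (h v - h u) - h (u + s *\<^sub>R (v - u)))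
      has_real_derivative (h v - h u) - (v - u) \<bullet> G) (at 0)"
    using GDERIV_line[of h u 0 "v - u" G] G by (auto intro!: derivative_eq_intros)
  then have "0 \<le> (h v - h u) - (v - u) \<bullet> G"
  proof (rule DERIV_nonneg_at_right_minimum)
    fix s :: real assume s: "0 < s" "s \<le> 1"
    have "h ((1 - s) *\<^sub>R u + s *\<^sub>R v) \<le> (1 - s) * h u + s * h v"
      using convex_onD[OF assms(1), of s u v] s by auto
    moreover have "(1 - s) *\<^sub>R u + s *\<^sub>R v = u + s *\<^sub>R (v - u)" by (simp add: algebra_simps)
    ultimately show "0 * (h v - h u) - h (u + 0 *\<^sub>R (v - u)) \<le> s * (h v - h u) - h (u + s *\<^sub>R (v - u))"
      by (simp add: algebra_simps)
  qed
  then show ?thesis by (simp add: inner_commute)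
qed

lemma GDERIV_norm_square: "GDERIV (\<lambda>u. c * (norm (u - v))\<^sup>2) u :> (2 * c) *\<^sub>R (u - v)"
proof -
  have "((\<lambda>u. c * ((u - v) \<bullet> (u - v))) has_derivative (\<lambda>h. h \<bullet> ((2 * c) *\<^sub>R (u - v)))) (at u)"
    by (auto intro!: derivative_eq_intros simp: fun_eq_iff inner_commute)
  then show ?thesis by (simp add: gderiv_def power2_norm_eq_inner)
qed

lemma strongly_convex_gradient_lower:
  assumes "strongly_convex \<mu> f" and G: "GDERIV f u :> G"
  shows "f u + G \<bullet> (v - u) + \<mu> / 2 * (norm (v - u))\<^sup>2 \<le> f v"
proof -
  have "GDERIV (\<lambda>u. f u - \<mu> / 2 * (norm u)\<^sup>2) u :> G - \<mu> *\<^sub>R u"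
    using GDERIV_diff[OF G GDERIV_norm_square[of "\<mu> / 2" 0 u]] by simp
  from convex_on_gradient_lower[OF assms(1)[unfolded strongly_convex_def] this, of v]
  show ?thesis
    by (simp add: power2_norm_eq_inner algebra_simps inner_commute)
qed

text \<open>The descent lemma. The gap \<open>k\<close> between \<open>f\<close> and its quadratic
  model along the segment has nonpositive derivative, so the gradient never has to be
  integrated.\<close>

lemma smooth_with_upper:
  assumes "smooth_with L f"
  shows "f v \<le> f u + gradient f u \<bullet> (v - u) + L / 2 * (norm (v - u))\<^sup>2"
proof -
  define d where "d = v - u"
  define k where "k s = f (u + s *\<^sub>R d) - s * (gradient f u \<bullet> d) - L / 2 * s\<^sup>2 * (norm d)\<^sup>2" for s :: real
  have "\<exists>y. (k has_real_derivative y) (at s) \<and> y \<le> 0" if s: "0 \<le> s" "s \<le> 1" for s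
  proof -
    have "GDERIV f (u + s *\<^sub>R d) :> gradient f (u + s *\<^sub>R d)"
      using assms by (simp add: smooth_with_def)
    from GDERIV_line[OF this]
    have 1: "(k has_real_derivative d \<bullet> gradient f (u + s *\<^sub>R d) - gradient f u \<bullet> d - L * s * (norm d)\<^sup>2) (at s)"
      unfolding k_def by (auto intro!: derivative_eq_intros)
    have "dist (gradient f (u + s *\<^sub>R d)) (gradient f u) \<le> L * dist (u + s *\<^sub>R d) u"
      using assms lipschitz_onD[of L UNIV "gradient f"] by (simp add: smooth_with_def)
    then have "norm (gradient f (u + s *\<^sub>R d) - gradient f u) \<le> L * s * norm d"
      using s by (simp add: dist_norm algebra_simps)
    then have "d \<bullet> (gradient f (u + s *\<^sub>R d) - gradient f u) \<le> norm d * (L * s * norm d)"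
      by (meson norm_cauchy_schwarz order_trans mult_left_mono norm_ge_zero)
    then have "d \<bullet> gradient f (u + s *\<^sub>R d) - gradient f u \<bullet> d - L * s * (norm d)\<^sup>2 \<le> 0"
      by (simp add: inner_diff_right inner_commute power2_eq_square algebra_simps)
    with 1 show ?thesis by blast
  qed
  then have "k 1 \<le> k 0" by (intro DERIV_nonpos_imp_nonincreasing[of 0 1 k]) auto
  then show ?thesis by (simp add: k_def d_def)
qed

text \<open>The quadratic lower and upper models at one point are compared at a unit vector, which
  exists since the dimension is positive. This yields \<open>\<eta> * m \<le> 1 / 2\<close> from
  \<open>\<eta> * L \<le> 1 / 2\<close>.\<close>

lemma strongly_convex_smooth_le:
  fixes f :: "'a::euclidean_space \<Rightarrow> real"
  assumes "strongly_convex \<mu> f" "smooth_with L f"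
  shows "\<mu> \<le> L"
proof -
  obtain b :: 'a where b: "b \<in> Basis" using nonempty_Basis by blast
  have "GDERIV f 0 :> gradient f 0" using assms by (simp add: smooth_with_def)
  from strongly_convex_gradient_lower[OF assms(1) this, of b] smooth_with_upper[OF assms(2), of b 0]
  show ?thesis using b by simp
qed

section \<open>Optimality conditions for proximal points and equilibria\<close>

text \<open>Convexity of the epigraph bounds \<open>r\<close> along the segment by the interpolation
  of its two finite end values. Only the smooth part is differentiated, and subgradients of
  \<open>r\<close> are avoided.\<close>

lemma argmin_variational:
  fixes r :: "'a::real_inner \<Rightarrow> ereal"
  assumes conv: "convex (ereal_epigraph r)" and G: "GDERIV \<phi> p :> G"
    and min: "\<And>u. ereal (\<phi> p) + r p \<le> ereal (\<phi> u) + r u"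
    and a: "r p = ereal a" and b: "r u = ereal b"
  shows "0 \<le> b - a + G \<bullet> (u - p)"
proof -
  have "((\<lambda>s. s * (b - a) + \<phi> (p + s *\<^sub>R (u - p)))
      has_real_derivative (b - a) + (u - p) \<bullet> G) (at 0)"
    using GDERIV_line[of \<phi> p 0 "u - p" G] G by (auto intro!: derivative_eq_intros)
  then have "0 \<le> (b - a) + (u - p) \<bullet> G"
  proof (rule DERIV_nonneg_at_right_minimum)
    fix s :: real assume s: "0 < s" "s \<le> 1"
    have "(p, a) \<in> ereal_epigraph r" "(u, b) \<in> ereal_epigraph r"
      using a b by (auto simp: ereal_epigraph_def)
    from convexD[OF conv this, of "1 - s" s] s
    have "r ((1 - s) *\<^sub>R p + s *\<^sub>R u) \<le> ereal ((1 - s) * a + s * b)"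
      by (simp add: ereal_epigraph_def)
    moreover have "(1 - s) *\<^sub>R p + s *\<^sub>R u = p + s *\<^sub>R (u - p)" by (simp add: algebra_simps)
    ultimately have "ereal (\<phi> p) + r p \<le> ereal (\<phi> (p + s *\<^sub>R (u - p))) + ereal ((1 - s) * a + s * b)"
      by (metis min add_left_mono order_trans)
    then show "0 * (b - a) + \<phi> (p + 0 *\<^sub>R (u - p)) \<le> s * (b - a) + \<phi> (p + s *\<^sub>R (u - p))"
      by (simp add: a algebra_simps)
  qed
  then show ?thesis by (simp add: inner_commute)
qed

lemma argmin_finite:
  fixes r :: "'a \<Rightarrow> ereal"
  assumes r: "\<And>u. r u \<noteq> -\<infinity>" "r u0 \<noteq> \<infinity>"
    and min: "\<And>u. ereal (\<phi> p) + r p \<le> ereal (\<phi> u) + r u"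
  obtains a where "r p = ereal a"
proof -
  have "r p \<noteq> \<infinity>" using min[of u0] r by (cases "r u0") auto
  with r(1)[of p] that show ?thesis by (cases "r p") auto
qed

text \<open>The condition at \<open>p\<close> is tested with \<open>q\<close> and the one at
  \<open>q\<close> with \<open>p\<close>; in their sum the values of \<open>r\<close>
  cancel.\<close>

lemma prox_equilibrium_variational:
  assumes r: "proper_closed_convex r" and \<eta>: "\<eta> > 0"
    and p: "is_prox \<eta> r v p" and q: "is_equilibrium fx r q" and G: "GDERIV (fx q) q :> G"
  shows "(p - v) \<bullet> (p - q) \<le> \<eta> * (G \<bullet> (p - q))"
proof -
  have ninf: "\<And>u. r u \<noteq> -\<infinity>" and conv: "convex (ereal_epigraph r)"
    using r by (auto simp: proper_closed_convex_def)
  obtain u0 where u0: "r u0 \<noteq> \<infinity>" using r by (auto simp: proper_closed_convex_def)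
  define \<phi> where "\<phi> u = 1 / (2 * \<eta>) * (norm (u - v))\<^sup>2" for u
  have min1: "ereal (\<phi> p) + r p \<le> ereal (\<phi> u) + r u" for u
    using p by (auto simp: is_prox_def is_arg_min_def \<phi>_def not_less add.commute)
  have min2: "ereal (fx q q) + r q \<le> ereal (fx q u) + r u" for u
    using q by (auto simp: is_equilibrium_def is_arg_min_def not_less)
  obtain a where a: "r p = ereal a" using argmin_finite[of r u0 \<phi> p, OF ninf u0 min1] by blast
  obtain b where b: "r q = ereal b" using argmin_finite[of r u0 "fx q" q, OF ninf u0 min2] by blast
  have "GDERIV \<phi> p :> (1 / \<eta>) *\<^sub>R (p - v)"
    using GDERIV_norm_square[of "1 / (2 * \<eta>)" v p] by (simp add: \<phi>_def[abs_def])
  from argmin_variational[OF conv this min1 a b] argmin_variational[OF conv G min2 b a]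
  have "0 \<le> ((p - v) \<bullet> (q - p)) / \<eta> + G \<bullet> (p - q)" by simp
  then have "0 \<le> (p - v) \<bullet> (q - p) + \<eta> * (G \<bullet> (p - q))"
    using \<eta> by (simp add: field_simps)
  then show ?thesis by (simp add: algebra_simps)
qed

section \<open>Error inequality for a single proximal step\<close>

lemma sensitivity_bound:
  assumes "ereal \<gamma> = sensitivity \<Omega> f" "\<omega> \<in> \<Omega>"
  shows "norm (gradient (f t \<omega> x) u - gradient (f t \<omega> y) u) \<le> \<gamma> * norm (x - y)"
proof (cases "x = y")
  case False
  have "ereal (norm (gradient (f t \<omega> x) u - gradient (f t \<omega> y) u) / norm (x - y)) \<le> ereal \<gamma>"
    unfolding assms(1) sensitivity_def using assms(2) False
    by (intro SUP_upper2[of "(t, \<omega>, u, x, y)"]) auto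
  with False show ?thesis by (simp add: pos_divide_le_eq)
qed simp

lemma sensitivity_nonneg:
  fixes f :: "nat \<Rightarrow> 'w \<Rightarrow> 'a::euclidean_space \<Rightarrow> 'a \<Rightarrow> real"
  assumes "ereal \<gamma> = sensitivity \<Omega> f" "\<omega> \<in> \<Omega>"
  shows "0 \<le> \<gamma>"
proof -
  obtain b :: 'a where b: "b \<in> Basis" using nonempty_Basis by blast
  have "0 \<le> \<gamma> * norm (b - 0)"
    using sensitivity_bound[OF assms, of _ b 0 0] norm_ge_zero order_trans by blast
  with b show ?thesis by simp
qed

text \<open>Strong convexity is used both at \<open>x\<close> and at \<open>q\<close>, so the gain
  \<open>\<eta> * (\<mu> - \<gamma>)\<close> appears on both sides. The surplus factor on the left
  is what later pays for the movement of the equilibrium.\<close>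

lemma prox_gradient_step:
  fixes x q p z :: "'a::real_inner"
  assumes r: "proper_closed_convex r" and \<eta>: "\<eta> > 0" "\<eta> * L \<le> 1 / 2" and \<gamma>: "0 \<le> \<gamma>"
    and h: "strongly_convex \<mu> (fx q)" "smooth_with L (fx q)"
    and sens: "norm (gradient (fx x) x - gradient (fx q) x) \<le> \<gamma> * norm (x - q)"
    and q: "is_equilibrium fx r q"
    and p: "is_prox \<eta> r (x - \<eta> *\<^sub>R g) p" and z: "z = gradient (fx x) x - g"
  shows "(1 + \<eta> * (\<mu> - \<gamma>)) * (norm (p - q))\<^sup>2
    \<le> (1 - \<eta> * (\<mu> - \<gamma>)) * (norm (x - q))\<^sup>2 + 2 * \<eta> * (z \<bullet> (x - q)) + 2 * \<eta>\<^sup>2 * (norm z)\<^sup>2"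
proof -
  define e where "e = gradient (fx x) x - gradient (fx q) x"
  define G0 where "G0 = gradient (fx q) x"
  define G where "G = gradient (fx q) q"
  have gd: "GDERIV (fx q) u :> gradient (fx q) u" for u using h(2) by (simp add: smooth_with_def)
  have g: "g = e + G0 - z" using z by (simp add: e_def G0_def)
  have 1: "(p - (x - \<eta> *\<^sub>R g)) \<bullet> (p - q) \<le> \<eta> * (G \<bullet> (p - q))"
    using prox_equilibrium_variational[OF r \<eta>(1) p q gd] by (simp add: G_def)
  have 2: "fx q p \<le> fx q x + G0 \<bullet> (p - x) + L / 2 * (norm (p - x))\<^sup>2"
    using smooth_with_upper[OF h(2)] by (simp add: G0_def)
  have 3: "fx q x + G0 \<bullet> (q - x) + \<mu> / 2 * (norm (q - x))\<^sup>2 \<le> fx q q"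
    using strongly_convex_gradient_lower[OF h(1) gd] by (simp add: G0_def)
  have 4: "fx q q + G \<bullet> (p - q) + \<mu> / 2 * (norm (p - q))\<^sup>2 \<le> fx q p"
    using strongly_convex_gradient_lower[OF h(1) gd] by (simp add: G_def)
  \<comment> \<open>In the sum of the three inequalities the values of \<open>fx q\<close> at
    \<open>p\<close>, \<open>x\<close> and \<open>q\<close> cancel.\<close>
  have coer: "\<mu> / 2 * ((norm (p - q))\<^sup>2 + (norm (x - q))\<^sup>2) - L / 2 * (norm (p - x))\<^sup>2 \<le> (G0 - G) \<bullet> (p - q)"
    using 2 3 4 by (simp add: norm_minus_commute[of q x] inner_diff_left inner_diff_right algebra_simps)
  \<comment> \<open>The error from taking the gradient at the wrong decision is split evenly between
    the two squared distances, so that \<open>\<gamma>\<close> is subtracted from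
    \<open>\<mu>\<close> in both.\<close>
  have "- (e \<bullet> (p - q)) \<le> norm e * norm (p - q)"
    using Cauchy_Schwarz_ineq2[of e "p - q"] by linarith
  also have "\<dots> \<le> \<gamma> * norm (x - q) * norm (p - q)"
    using sens by (intro mult_right_mono) (auto simp: e_def)
  also have "\<dots> \<le> \<gamma> / 2 * ((norm (p - q))\<^sup>2 + (norm (x - q))\<^sup>2)"
    using \<gamma> mult_left_mono[OF sum_squares_bound[of "norm (x - q)" "norm (p - q)"], of "\<gamma> / 2"]
    by (simp add: algebra_simps)
  finally have err: "- (\<gamma> / 2 * ((norm (p - q))\<^sup>2 + (norm (x - q))\<^sup>2)) \<le> e \<bullet> (p - q)" by simp
  have low: "(\<mu> - \<gamma>) / 2 * ((norm (p - q))\<^sup>2 + (norm (x - q))\<^sup>2) - L / 2 * (norm (p - x))\<^sup>2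
      \<le> (e + G0 - G) \<bullet> (p - q)"
    using coer err by (simp add: inner_diff_left inner_add_left field_simps)
  have "2 * ((p - x) \<bullet> (p - q)) = (norm (p - x))\<^sup>2 + (norm (p - q))\<^sup>2 - (norm (x - q))\<^sup>2"
    by (simp add: power2_norm_eq_inner inner_diff_left inner_diff_right inner_commute)
  moreover have "(p - x) \<bullet> (p - q) \<le> - \<eta> * ((e + G0 - G) \<bullet> (p - q)) + \<eta> * (z \<bullet> (p - q))"
    using 1 unfolding g by (simp add: inner_diff_left inner_diff_right inner_add_left algebra_simps)
  ultimately have "(norm (p - q))\<^sup>2 \<le> (norm (x - q))\<^sup>2 - (norm (p - x))\<^sup>2
      - 2 * \<eta> * ((e + G0 - G) \<bullet> (p - q)) + 2 * \<eta> * (z \<bullet> (p - q))"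
    by linarith
  \<comment> \<open>\<open>p\<close> depends on the noise, whereas \<open>x - q\<close> is known
    beforehand. Only the first part is kept as a linear term.\<close>
  also have "2 * \<eta> * (z \<bullet> (p - q)) = 2 * \<eta> * (z \<bullet> (x - q)) + 2 * \<eta> * (z \<bullet> (p - x))"
    by (simp add: inner_diff_right algebra_simps)
  finally have main: "(norm (p - q))\<^sup>2 \<le> (norm (x - q))\<^sup>2 - (norm (p - x))\<^sup>2
      - 2 * \<eta> * ((e + G0 - G) \<bullet> (p - q)) + 2 * \<eta> * (z \<bullet> (x - q)) + 2 * \<eta> * (z \<bullet> (p - x))"
    by simp
  have low': "\<eta> * (\<mu> - \<gamma>) * ((norm (p - q))\<^sup>2 + (norm (x - q))\<^sup>2) - \<eta> * L * (norm (p - x))\<^sup>2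
      \<le> 2 * \<eta> * ((e + G0 - G) \<bullet> (p - q))"
    using mult_left_mono[OF low, of "2 * \<eta>"] \<eta>(1) by (simp add: field_simps)
  \<comment> \<open>The negative term \<open>(norm (p - x))\<^sup>2\<close> has two debts to cover:
    one half goes to this noise term, the other to the smoothness error, by
    \<open>\<eta> * L \<le> 1 / 2\<close>.\<close>
  have "z \<bullet> (p - x) \<le> norm z * norm (p - x)" by (rule norm_cauchy_schwarz)
  then have "2 * \<eta> * (z \<bullet> (p - x)) \<le> 2 * \<eta> * norm z * norm (p - x)"
    using mult_left_mono[of _ _ "2 * \<eta>"] \<eta>(1) by (simp add: mult.assoc)
  also have "\<dots> \<le> (norm (p - x))\<^sup>2 / 2 + 2 * \<eta>\<^sup>2 * (norm z)\<^sup>2"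
    using zero_le_power2[of "norm (p - x) - 2 * \<eta> * norm z"]
    by (simp add: power2_eq_square algebra_simps)
  finally have yz: "2 * \<eta> * (z \<bullet> (p - x)) \<le> (norm (p - x))\<^sup>2 / 2 + 2 * \<eta>\<^sup>2 * (norm z)\<^sup>2" .
  have "\<eta> * L * (norm (p - x))\<^sup>2 \<le> 1 / 2 * (norm (p - x))\<^sup>2"
    by (intro mult_right_mono \<eta>) simp
  with main low' yz show ?thesis by (simp add: algebra_simps)
qed

lemma norm_triangle_square_weighted:
  fixes a b :: "'a::real_inner"
  assumes "c > 0"
  shows "(norm (a + b))\<^sup>2 \<le> (1 + c) * (norm a)\<^sup>2 + (1 + 1 / c) * (norm b)\<^sup>2"
proof -
  have "0 \<le> (c * norm a - norm b)\<^sup>2 / c" using assms by simp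
  also have "\<dots> = c * (norm a)\<^sup>2 + (norm b)\<^sup>2 / c - 2 * norm a * norm b"
    using assms by (simp add: power2_eq_square field_simps)
  finally have "2 * norm a * norm b \<le> c * (norm a)\<^sup>2 + (norm b)\<^sup>2 / c" by simp
  moreover have "(norm (a + b))\<^sup>2 \<le> (norm a + norm b)\<^sup>2"
    by (intro power_mono norm_triangle_ineq) simp
  ultimately show ?thesis by (simp add: power2_sum algebra_simps)
qed

text \<open>The weight \<open>\<eta> * m\<close> in the weighted triangle inequality makes the
  factor of \<open>norm (p - q)\<close> squared exactly the left-hand side of
  \<open>prox_gradient_step\<close>. The remaining factor \<open>1 + 1 / (\<eta> * m)\<close> is
  simplified by \<open>\<eta> * m \<le> 1 / 2\<close>.\<close>

lemma tracking_step:
  fixes x q q' p z :: "'a::real_inner"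
  assumes r: "proper_closed_convex r" and \<eta>: "\<eta> > 0" "\<eta> * L \<le> 1 / 2" and \<gamma>: "0 \<le> \<gamma>" "\<gamma> < \<mu>" "\<mu> \<le> L"
    and h: "strongly_convex \<mu> (fx q)" "smooth_with L (fx q)"
    and sens: "norm (gradient (fx x) x - gradient (fx q) x) \<le> \<gamma> * norm (x - q)"
    and q: "is_equilibrium fx r q"
    and p: "is_prox \<eta> r (x - \<eta> *\<^sub>R g) p" and z: "z = gradient (fx x) x - g"
    and m: "m = \<mu> - \<gamma>"
  shows "(norm (p - q'))\<^sup>2 \<le> (1 - \<eta> * m) * (norm (x - q))\<^sup>2 + 2 * \<eta> * (z \<bullet> (x - q))
    + 2 * \<eta>\<^sup>2 * (norm z)\<^sup>2 + 3 / (2 * \<eta> * m) * (norm (q - q'))\<^sup>2"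
proof -
  have pos: "\<eta> * m > 0" using \<eta> \<gamma> m by simp
  have "\<eta> * m \<le> \<eta> * L" using \<eta> \<gamma> m by (intro mult_left_mono) auto
  then have le: "\<eta> * m \<le> 1 / 2" using \<eta> by linarith
  have "1 + 1 / (\<eta> * m) \<le> 3 / (2 * \<eta> * m)"
    using pos le by (simp add: field_simps)
  then have "(1 + 1 / (\<eta> * m)) * (norm (q - q'))\<^sup>2 \<le> 3 / (2 * \<eta> * m) * (norm (q - q'))\<^sup>2"
    by (intro mult_right_mono) auto
  with norm_triangle_square_weighted[OF pos, of "p - q" "q - q'"]
    prox_gradient_step[OF r \<eta> \<gamma>(1) h sens q p z]
  show ?thesis by (simp add: m)
qed

section \<open>Conditional exponential moments of the noise\<close>

text \<open>A conditional expectation bounded by one, tested against nonnegative weights so that no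
  integrability of the weights is needed.\<close>
definition cond_submean :: "'a measure \<Rightarrow> 'a measure \<Rightarrow> ('a \<Rightarrow> real) \<Rightarrow> bool" where
  "cond_submean M F X \<longleftrightarrow> X \<in> borel_measurable M \<and>
     (\<forall>W\<in>borel_measurable F. (\<integral>\<^sup>+\<omega>. W \<omega> * ennreal (X \<omega>) \<partial>M) \<le> (\<integral>\<^sup>+\<omega>. W \<omega> \<partial>M))"

lemma cond_submean_measurable [measurable_dest]: "cond_submean M F X \<Longrightarrow> X \<in> borel_measurable M"
  by (simp add: cond_submean_def)

lemma cond_submeanD:
  "cond_submean M F X \<Longrightarrow> W \<in> borel_measurable F \<Longrightarrow>
    (\<integral>\<^sup>+\<omega>. W \<omega> * ennreal (X \<omega>) \<partial>M) \<le> (\<integral>\<^sup>+\<omega>. W \<omega> \<partial>M)"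
  by (simp add: cond_submean_def)

lemma cond_submean_one: "cond_submean M F (\<lambda>_. 1)"
  by (simp add: cond_submean_def)

lemma cond_submean_mono:
  assumes "cond_submean M F Y" "X \<in> borel_measurable M" "\<And>\<omega>. \<omega> \<in> space M \<Longrightarrow> X \<omega> \<le> Y \<omega>"
  shows "cond_submean M F X"
  unfolding cond_submean_def
proof (intro conjI ballI assms(2))
  fix W :: "_ \<Rightarrow> ennreal" assume "W \<in> borel_measurable F"
  have "(\<integral>\<^sup>+\<omega>. W \<omega> * ennreal (X \<omega>) \<partial>M) \<le> (\<integral>\<^sup>+\<omega>. W \<omega> * ennreal (Y \<omega>) \<partial>M)"
    by (intro nn_integral_mono mult_left_mono ennreal_leI assms(3)) auto
  also have "\<dots> \<le> (\<integral>\<^sup>+\<omega>. W \<omega> \<partial>M)" by (rule cond_submeanD) fact+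
  finally show "(\<integral>\<^sup>+\<omega>. W \<omega> * ennreal (X \<omega>) \<partial>M) \<le> (\<integral>\<^sup>+\<omega>. W \<omega> \<partial>M)" .
qed

text \<open>A random weight \<open>\<theta>\<close> measurable for \<open>F\<close> can be absorbed
  into the test weight \<open>W\<close>. This covers both random exponents and the constant weights
  that split dependent terms.\<close>

lemma cond_submean_convex:
  assumes sub: "subalgebra M F" and X: "cond_submean M F X" and Y: "cond_submean M F Y"
    and nn: "\<And>\<omega>. 0 \<le> X \<omega>" "\<And>\<omega>. 0 \<le> Y \<omega>"
    and \<theta> [measurable]: "\<theta> \<in> borel_measurable F" and "\<And>\<omega>. 0 \<le> \<theta> \<omega>" "\<And>\<omega>. \<theta> \<omega> \<le> 1"
  shows "cond_submean M F (\<lambda>\<omega>. \<theta> \<omega> * X \<omega> + (1 - \<theta> \<omega>) * Y \<omega>)"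
  unfolding cond_submean_def
proof (intro conjI ballI)
  note [measurable] = X Y measurable_from_subalg[OF sub \<theta>]
  show "(\<lambda>\<omega>. \<theta> \<omega> * X \<omega> + (1 - \<theta> \<omega>) * Y \<omega>) \<in> borel_measurable M" by measurable
  fix W :: "_ \<Rightarrow> ennreal" assume W [measurable]: "W \<in> borel_measurable F"
  note [measurable] = measurable_from_subalg[OF sub W]
  have "(\<integral>\<^sup>+\<omega>. W \<omega> * ennreal (\<theta> \<omega> * X \<omega> + (1 - \<theta> \<omega>) * Y \<omega>) \<partial>M)
      = (\<integral>\<^sup>+\<omega>. W \<omega> * ennreal (\<theta> \<omega>) * ennreal (X \<omega>) + W \<omega> * ennreal (1 - \<theta> \<omega>) * ennreal (Y \<omega>) \<partial>M)"
    using assms by (intro nn_integral_cong) (simp add: ennreal_plus ennreal_mult distrib_left mult.assoc)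
  also have "\<dots> = (\<integral>\<^sup>+\<omega>. W \<omega> * ennreal (\<theta> \<omega>) * ennreal (X \<omega>) \<partial>M)
      + (\<integral>\<^sup>+\<omega>. W \<omega> * ennreal (1 - \<theta> \<omega>) * ennreal (Y \<omega>) \<partial>M)"
    by (intro nn_integral_add) measurable
  also have "\<dots> \<le> (\<integral>\<^sup>+\<omega>. W \<omega> * ennreal (\<theta> \<omega>) \<partial>M) + (\<integral>\<^sup>+\<omega>. W \<omega> * ennreal (1 - \<theta> \<omega>) \<partial>M)"
    by (intro add_mono cond_submeanD X Y) measurable
  also have "\<dots> = (\<integral>\<^sup>+\<omega>. W \<omega> * ennreal (\<theta> \<omega>) + W \<omega> * ennreal (1 - \<theta> \<omega>) \<partial>M)"
    by (intro nn_integral_add[symmetric]) measurable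
  also have "\<dots> = (\<integral>\<^sup>+\<omega>. W \<omega> \<partial>M)"
    using assms by (intro nn_integral_cong) (simp add: distrib_left[symmetric] ennreal_plus[symmetric] del: ennreal_plus)
  finally show "(\<integral>\<^sup>+\<omega>. W \<omega> * ennreal (\<theta> \<omega> * X \<omega> + (1 - \<theta> \<omega>) * Y \<omega>) \<partial>M) \<le> (\<integral>\<^sup>+\<omega>. W \<omega> \<partial>M)" .
qed

section \<open>Elementary exponential inequalities\<close>

lemma exp_convex_combination:
  fixes x y \<theta> :: real
  assumes "0 \<le> \<theta>" "\<theta> \<le> 1"
  shows "exp (\<theta> * x + (1 - \<theta>) * y) \<le> \<theta> * exp x + (1 - \<theta>) * exp y"
  using convex_onD[OF exp_convex, of "1 - \<theta>" x y] assms by simp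

text \<open>The linear term stands alone with coefficient one, so that it disappears under a
  conditional expectation when \<open>u\<close> is centred; what remains is controlled by the moment
  of a square.\<close>

lemma exp_le_add_exp_square: "exp (u::real) \<le> u + exp (u\<^sup>2)"
proof -
  have sq: "1 + u\<^sup>2 \<le> exp (u\<^sup>2)" by (rule exp_ge_add_one_self)
  consider "u < 0" | "0 \<le> u" "u \<le> 1" | "1 < u" by linarith
  then show ?thesis
  proof cases
    case 1
    define t where "t = - u"
    have t: "t > 0" using 1 by (simp add: t_def)
    \<comment> \<open>Multiplication by the Taylor polynomial of \<open>exp t\<close> turns the
      claim \<open>exp (- t) \<le> 1 - t + t\<^sup>2\<close> into a polynomial identity with
      nonnegative remainder.\<close>
    have "(1 - t + t\<^sup>2) * (1 + t + t\<^sup>2 / 2) = 1 + (t^2 + t^3 + t^4) / 2"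
      by (simp add: power2_eq_square power3_eq_cube power4_eq_xxxx field_simps)
    then have "1 \<le> (1 - t + t\<^sup>2) * (1 + t + t\<^sup>2 / 2)"
      using t by simp
    also have "\<dots> \<le> (1 - t + t\<^sup>2) * exp t"
      using t exp_lower_Taylor_quadratic[of t] sum_power2_ge_zero[of "t - 1/2" 0]
      by (intro mult_left_mono) (auto simp: power2_eq_square algebra_simps)
    finally have "exp (- t) \<le> 1 - t + t\<^sup>2"
      by (simp add: exp_minus field_simps)
    then have "exp u \<le> 1 + u + u\<^sup>2" by (simp add: t_def)
    with sq show ?thesis by linarith
  next
    case 2
    with exp_bound[of u] sq show ?thesis by linarith
  next
    case 3
    then have "exp u \<le> exp (u\<^sup>2)" by (simp add: power2_eq_square)
    with 3 show ?thesis by linarith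
  qed
qed

lemma ln_3_le: "ln 3 \<le> (3/2::real)"
proof -
  have "3 \<le> exp (3/2::real)"
    using exp_lower_Taylor_quadratic[of "3/2::real"] by (simp add: power2_eq_square)
  then have "ln 3 \<le> ln (exp (3/2::real))" by (subst ln_le_cancel_iff) auto
  then show ?thesis by simp
qed

section \<open>From conditional bounds and tails to weighted exponential moments\<close>

context finite_measure_subalgebra
begin

lemma cond_submean_of_nn_cond_exp:
  assumes [measurable]: "X \<in> borel_measurable M" and nn: "\<And>\<omega>. 0 \<le> X \<omega>" and c: "c > 0"
    and le: "AE \<omega> in M. nn_cond_exp M F (\<lambda>\<omega>. ennreal (X \<omega>)) \<omega> \<le> ennreal c"
  shows "cond_submean M F (\<lambda>\<omega>. X \<omega> / c)"
  unfolding cond_submean_def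
proof (intro conjI ballI)
  show "(\<lambda>\<omega>. X \<omega> / c) \<in> borel_measurable M" by measurable
  fix W :: "_ \<Rightarrow> ennreal" assume W [measurable]: "W \<in> borel_measurable F"
  have "(\<integral>\<^sup>+\<omega>. W \<omega> * ennreal (X \<omega> / c) \<partial>M) = (\<integral>\<^sup>+\<omega>. (W \<omega> * ennreal (1 / c)) * ennreal (X \<omega>) \<partial>M)"
    using c nn by (intro nn_integral_cong) (simp add: mult.assoc ennreal_mult[symmetric])
  also have "\<dots> = (\<integral>\<^sup>+\<omega>. (W \<omega> * ennreal (1 / c)) * nn_cond_exp M F (\<lambda>\<omega>. ennreal (X \<omega>)) \<omega> \<partial>M)"
    by (rule nn_cond_exp_intg[symmetric]) measurable
  also have "\<dots> \<le> (\<integral>\<^sup>+\<omega>. (W \<omega> * ennreal (1 / c)) * ennreal c \<partial>M)"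
    using le by (intro nn_integral_mono_AE) (auto elim!: eventually_mono intro: mult_left_mono)
  also have "\<dots> = (\<integral>\<^sup>+\<omega>. W \<omega> \<partial>M)"
    using c by (intro nn_integral_cong) (simp add: mult.assoc ennreal_mult[symmetric])
  finally show "(\<integral>\<^sup>+\<omega>. W \<omega> * ennreal (X \<omega> / c) \<partial>M) \<le> (\<integral>\<^sup>+\<omega>. W \<omega> \<partial>M)" .
qed

text \<open>\<open>real_cond_exp\<close> converts nonnegative conditional expectations to reals,
  which would send an infinite value to 0. Integrability excludes infinity almost
  everywhere.\<close>

lemma nn_cond_exp_eq_real_cond_exp:
  assumes X: "integrable M X" and nn: "\<And>\<omega>. 0 \<le> X \<omega>"
  shows "AE \<omega> in M. nn_cond_exp M F (\<lambda>\<omega>. ennreal (X \<omega>)) \<omega> = ennreal (real_cond_exp M F X \<omega>)"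
proof -
  have [measurable]: "X \<in> borel_measurable M" using X by simp
  have "(\<integral>\<^sup>+\<omega>. nn_cond_exp M F (\<lambda>\<omega>. ennreal (X \<omega>)) \<omega> \<partial>M) = (\<integral>\<^sup>+\<omega>. ennreal (X \<omega>) \<partial>M)"
    using nn_cond_exp_intg[of "\<lambda>_. 1" "\<lambda>\<omega>. ennreal (X \<omega>)"] by simp
  also have "\<dots> \<noteq> \<infinity>" using X nn by (simp add: nn_integral_eq_integral)
  finally have "AE \<omega> in M. nn_cond_exp M F (\<lambda>\<omega>. ennreal (X \<omega>)) \<omega> \<noteq> \<infinity>"
    by (intro nn_integral_noteq_infinite) auto
  moreover have "AE \<omega> in M. 0 = nn_cond_exp M F (\<lambda>\<omega>. ennreal (- X \<omega>)) \<omega>"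
    using nn_cond_exp_F_meas[of "\<lambda>_. 0"] nn by (simp add: ennreal_neg)
  ultimately show ?thesis
    by eventually_elim (simp add: real_cond_exp_def top.not_eq_extremum)
qed

text \<open>Layer-cake integration: one plus the integral of
  \<open>exp y * (2 * exp (- 2 * y))\<close> over the half-line is 3. Each tail bound has its own
  null set, and there are uncountably many; testing against \<open>W\<close> first turns each bound
  into an inequality of integrals, so the null sets need not be combined.\<close>

lemma cond_submean_exp_tail:
  assumes Y [measurable]: "Y \<in> borel_measurable M" and nn: "\<And>\<omega>. 0 \<le> Y \<omega>"
    and tail: "\<And>s. s > 0 \<Longrightarrow>
      AE \<omega> in M. real_cond_exp M F (indicator {\<omega> \<in> space M. s \<le> Y \<omega>}) \<omega> \<le> 2 * exp (- 2 * s)"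
  shows "cond_submean M F (\<lambda>\<omega>. exp (Y \<omega>) / 3)"
  unfolding cond_submean_def
proof (intro conjI ballI)
  show "(\<lambda>\<omega>. exp (Y \<omega>) / 3) \<in> borel_measurable M" by measurable
  fix W :: "_ \<Rightarrow> ennreal" assume W [measurable]: "W \<in> borel_measurable F"
  have WM [measurable]: "W \<in> borel_measurable M" by (rule measurable_from_subalg[OF subalg W])
  interpret P: pair_sigma_finite M lborel
    by (intro pair_sigma_finite.intro sigma_finite_measure_axioms sigma_finite_lborel)
  have tailW: "(\<integral>\<^sup>+\<omega>. W \<omega> * indicator {\<omega> \<in> space M. s \<le> Y \<omega>} \<omega> \<partial>M)
      \<le> ennreal (2 * exp (- 2 * s)) * (\<integral>\<^sup>+\<omega>. W \<omega> \<partial>M)" if s: "s > 0" for s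
  proof -
    define A where "A = {\<omega> \<in> space M. s \<le> Y \<omega>}"
    have [measurable]: "A \<in> sets M" unfolding A_def by measurable
    have "integrable M (indicator A :: _ \<Rightarrow> real)"
      by (simp add: top.not_eq_extremum[symmetric])
    from nn_cond_exp_eq_real_cond_exp[OF this indicator_pos_le] tail[OF s, folded A_def]
    have "AE \<omega> in M. nn_cond_exp M F (\<lambda>\<omega>. ennreal (indicator A \<omega>)) \<omega> \<le> ennreal (2 * exp (- 2 * s))"
      by eventually_elim (simp_all add: ennreal_leI)
    then have "cond_submean M F (\<lambda>\<omega>. indicator A \<omega> / (2 * exp (- 2 * s)))"
      by (intro cond_submean_of_nn_cond_exp) auto
    from cond_submeanD[OF this, of "\<lambda>\<omega>. ennreal (2 * exp (- 2 * s)) * W \<omega>"]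
    have "(\<integral>\<^sup>+\<omega>. ennreal (2 * exp (- 2 * s)) * W \<omega> * ennreal (indicator A \<omega> / (2 * exp (- 2 * s))) \<partial>M)
      \<le> ennreal (2 * exp (- 2 * s)) * (\<integral>\<^sup>+\<omega>. W \<omega> \<partial>M)"
      by (simp add: nn_integral_cmult)
    also have "(\<integral>\<^sup>+\<omega>. ennreal (2 * exp (- 2 * s)) * W \<omega> * ennreal (indicator A \<omega> / (2 * exp (- 2 * s))) \<partial>M)
      = (\<integral>\<^sup>+\<omega>. W \<omega> * indicator A \<omega> \<partial>M)"
      by (intro nn_integral_cong) (auto split: split_indicator simp: mult.commute mult.left_commute ennreal_mult[symmetric])
    finally show ?thesis by (simp add: A_def)
  qed
  have cake: "ennreal (exp (Y \<omega>)) = 1 + (\<integral>\<^sup>+y. ennreal (exp y) * indicator {0..Y \<omega>} y \<partial>lborel)" for \<omega>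
    using nn nn_integral_FTC_Icc[of exp 0 "Y \<omega>" exp]
    by (auto simp: DERIV_exp ennreal_1[symmetric] ennreal_plus[symmetric] simp del: ennreal_1 ennreal_plus
        intro: DERIV_subset)
  have "(\<integral>\<^sup>+\<omega>. W \<omega> * ennreal (exp (Y \<omega>)) \<partial>M)
      = (\<integral>\<^sup>+\<omega>. W \<omega> + (\<integral>\<^sup>+y. W \<omega> * (ennreal (exp y) * indicator {0..Y \<omega>} y) \<partial>lborel) \<partial>M)"
    by (simp add: cake distrib_left nn_integral_cmult)
  also have "\<dots> = (\<integral>\<^sup>+\<omega>. W \<omega> \<partial>M)
      + (\<integral>\<^sup>+\<omega>. (\<integral>\<^sup>+y. W \<omega> * (ennreal (exp y) * indicator {0..Y \<omega>} y) \<partial>lborel) \<partial>M)"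
    by (rule nn_integral_add) (measurable, simp add: atLeastAtMost_def)
  also have "(\<integral>\<^sup>+\<omega>. (\<integral>\<^sup>+y. W \<omega> * (ennreal (exp y) * indicator {0..Y \<omega>} y) \<partial>lborel) \<partial>M)
      = (\<integral>\<^sup>+y. (\<integral>\<^sup>+\<omega>. W \<omega> * (ennreal (exp y) * indicator {0..Y \<omega>} y) \<partial>M) \<partial>lborel)"
    by (rule P.Fubini'[symmetric]) (simp add: indicator_def)
  also have "\<dots> \<le> (\<integral>\<^sup>+y. (ennreal (2 * exp (- y)) * indicator {0..} y) * (\<integral>\<^sup>+\<omega>. W \<omega> \<partial>M) \<partial>lborel)"
  proof (rule nn_integral_mono_AE)
    \<comment> \<open>The tail is known for positive levels only; the level 0 is a null set, and at
      negative levels the integrand vanishes.\<close>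
    have "AE y in lborel. y \<noteq> (0::real)" by (rule AE_lborel_singleton)
    then show "AE y in lborel. (\<integral>\<^sup>+\<omega>. W \<omega> * (ennreal (exp y) * indicator {0..Y \<omega>} y) \<partial>M)
        \<le> (ennreal (2 * exp (- y)) * indicator {0..} y) * (\<integral>\<^sup>+\<omega>. W \<omega> \<partial>M)"
    proof eventually_elim
      case (elim y)
      show ?case
      proof (cases "y > 0")
        case True
        have "(\<integral>\<^sup>+\<omega>. W \<omega> * (ennreal (exp y) * indicator {0..Y \<omega>} y) \<partial>M)
            = (\<integral>\<^sup>+\<omega>. ennreal (exp y) * (W \<omega> * indicator {\<omega> \<in> space M. y \<le> Y \<omega>} \<omega>) \<partial>M)"
          using True by (intro nn_integral_cong) (auto split: split_indicator simp: mult.commute)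
        also have "\<dots> = ennreal (exp y) * (\<integral>\<^sup>+\<omega>. W \<omega> * indicator {\<omega> \<in> space M. y \<le> Y \<omega>} \<omega> \<partial>M)"
          by (rule nn_integral_cmult) measurable
        also have "\<dots> \<le> ennreal (exp y) * (ennreal (2 * exp (- 2 * y)) * (\<integral>\<^sup>+\<omega>. W \<omega> \<partial>M))"
          by (intro mult_left_mono tailW True) simp
        also have "\<dots> = ennreal (exp y * (2 * exp (- 2 * y))) * (\<integral>\<^sup>+\<omega>. W \<omega> \<partial>M)"
          by (simp add: mult.assoc[symmetric] ennreal_mult)
        also have "exp y * (2 * exp (- 2 * y)) = 2 * exp (- y)"
          by (simp add: exp_add[symmetric] mult.left_commute)
        finally show ?thesis using True by simp
      next
        case False
        with elim have "y < 0" by simp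
        then show ?thesis by simp
      qed
    qed
  qed
  also have "\<dots> = (\<integral>\<^sup>+y. ennreal (2 * exp (- y)) * indicator {0..} y \<partial>lborel) * (\<integral>\<^sup>+\<omega>. W \<omega> \<partial>M)"
    by (rule nn_integral_multc) measurable
  also have "(\<integral>\<^sup>+y. ennreal (2 * exp (- y)) * indicator {0..} y \<partial>lborel) = ennreal (0 - (- 2 * exp (- 0)))"
  proof (rule nn_integral_FTC_atLeast)
    show "((\<lambda>y::real. - 2 * exp (- y)) \<longlongrightarrow> 0) at_top"
      by (rule tendsto_mult_right_zero) (rule filterlim_compose[OF exp_at_bot filterlim_uminus_at_bot_at_top])
  qed (auto intro!: derivative_eq_intros)
  finally have "(\<integral>\<^sup>+\<omega>. W \<omega> * ennreal (exp (Y \<omega>)) \<partial>M) \<le> 1 * (\<integral>\<^sup>+\<omega>. W \<omega> \<partial>M) + 2 * (\<integral>\<^sup>+\<omega>. W \<omega> \<partial>M)"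
    by simp
  also have "\<dots> = (1 + 2) * (\<integral>\<^sup>+\<omega>. W \<omega> \<partial>M)" by (simp only: distrib_right)
  also have "1 + 2 = (3::ennreal)" by simp
  finally have "(\<integral>\<^sup>+\<omega>. W \<omega> * ennreal (exp (Y \<omega>)) \<partial>M) \<le> 3 * (\<integral>\<^sup>+\<omega>. W \<omega> \<partial>M)" .
  then have "ennreal (1 / 3) * (\<integral>\<^sup>+\<omega>. W \<omega> * ennreal (exp (Y \<omega>)) \<partial>M) \<le> ennreal (1 / 3) * (3 * (\<integral>\<^sup>+\<omega>. W \<omega> \<partial>M))"
    by (rule mult_left_mono) simp
  also have "\<dots> = (\<integral>\<^sup>+\<omega>. W \<omega> \<partial>M)"
    by (simp add: mult.assoc[symmetric] ennreal_numeral[symmetric] ennreal_mult[symmetric] del: ennreal_numeral)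
  also have "ennreal (1 / 3) * (\<integral>\<^sup>+\<omega>. W \<omega> * ennreal (exp (Y \<omega>)) \<partial>M)
      = (\<integral>\<^sup>+\<omega>. ennreal (1 / 3) * (W \<omega> * ennreal (exp (Y \<omega>))) \<partial>M)"
    by (rule nn_integral_cmult[symmetric]) measurable
  also have "\<dots> = (\<integral>\<^sup>+\<omega>. W \<omega> * ennreal (exp (Y \<omega>) / 3) \<partial>M)"
    by (intro nn_integral_cong) (simp add: mult.left_commute ennreal_mult[symmetric])
  finally show "(\<integral>\<^sup>+\<omega>. W \<omega> * ennreal (exp (Y \<omega>) / 3) \<partial>M) \<le> (\<integral>\<^sup>+\<omega>. W \<omega> \<partial>M)" .
qed

text \<open>The product of \<open>q\<close> with an arbitrary weight might not be integrable. The
  centred term is therefore removed between conditional expectations, before any weight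
  appears.\<close>

lemma cond_submean_add_centered:
  assumes Y: "cond_submean M F Y" and q: "integrable M q" "AE \<omega> in M. real_cond_exp M F q \<omega> = 0"
    and [measurable]: "X \<in> borel_measurable M" and nn: "\<And>\<omega>. 0 \<le> X \<omega>" "\<And>\<omega>. 0 \<le> Y \<omega>"
    and le: "\<And>\<omega>. \<omega> \<in> space M \<Longrightarrow> X \<omega> \<le> q \<omega> + Y \<omega>"
  shows "cond_submean M F X"
  unfolding cond_submean_def
proof (intro conjI ballI)
  show "X \<in> borel_measurable M" by fact
  note [measurable] = Y
  \<comment> \<open>Testing with the constant weight 1 makes \<open>Y\<close> integrable;
    \<open>X\<close> is then dominated by \<open>q + Y\<close>.\<close>
  have "(\<integral>\<^sup>+\<omega>. ennreal (norm (Y \<omega>)) \<partial>M) \<le> emeasure M (space M)"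
    using cond_submeanD[OF Y, of "\<lambda>_. 1"] nn by simp
  also have "\<dots> < \<infinity>" by (simp add: top.not_eq_extremum[symmetric])
  finally have iY: "integrable M Y" by (intro integrableI_bounded) measurable
  have iX: "integrable M X"
    by (rule Bochner_Integration.integrable_bound[of M "\<lambda>\<omega>. q \<omega> + Y \<omega>"])
      (use q(1) iY le nn in \<open>auto intro!: AE_I2 order_trans[OF le abs_ge_self]\<close>)
  have "AE \<omega> in M. real_cond_exp M F X \<omega> \<le> real_cond_exp M F (\<lambda>\<omega>. q \<omega> + Y \<omega>) \<omega>"
    using le by (intro real_cond_exp_mono iX Bochner_Integration.integrable_add q(1) iY) auto
  then have ce: "AE \<omega> in M. nn_cond_exp M F (\<lambda>\<omega>. ennreal (X \<omega>)) \<omega> \<le> nn_cond_exp M F (\<lambda>\<omega>. ennreal (Y \<omega>)) \<omega>"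
    using real_cond_exp_add[OF q(1) iY] q(2) nn_cond_exp_eq_real_cond_exp[OF iX nn(1)]
      nn_cond_exp_eq_real_cond_exp[OF iY nn(2)]
    by eventually_elim (simp add: ennreal_leI)
  fix W :: "_ \<Rightarrow> ennreal" assume W [measurable]: "W \<in> borel_measurable F"
  have "(\<integral>\<^sup>+\<omega>. W \<omega> * ennreal (X \<omega>) \<partial>M) = (\<integral>\<^sup>+\<omega>. W \<omega> * nn_cond_exp M F (\<lambda>\<omega>. ennreal (X \<omega>)) \<omega> \<partial>M)"
    by (rule nn_cond_exp_intg[symmetric]) measurable
  also have "\<dots> \<le> (\<integral>\<^sup>+\<omega>. W \<omega> * nn_cond_exp M F (\<lambda>\<omega>. ennreal (Y \<omega>)) \<omega> \<partial>M)"
    using ce by (intro nn_integral_mono_AE) (auto elim!: eventually_mono intro: mult_left_mono)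
  also have "\<dots> = (\<integral>\<^sup>+\<omega>. W \<omega> * ennreal (Y \<omega>) \<partial>M)"
    by (rule nn_cond_exp_intg) measurable
  also have "\<dots> \<le> (\<integral>\<^sup>+\<omega>. W \<omega> \<partial>M)" by (rule cond_submeanD[OF Y W])
  finally show "(\<integral>\<^sup>+\<omega>. W \<omega> * ennreal (X \<omega>) \<partial>M) \<le> (\<integral>\<^sup>+\<omega>. W \<omega> \<partial>M)" .
qed


section \<open>Sub-Gaussian moments of the noise with random coefficients\<close>

text \<open>A conditional Jensen inequality with a random exponent: convexity of \<open>exp\<close>
  between \<open>Y - ln c\<close> and 0.\<close>

lemma cond_submean_exp_power:
  assumes Y: "cond_submean M F (\<lambda>\<omega>. exp (Y \<omega>) / c)" and c: "c > 0"
    and \<theta> [measurable]: "\<theta> \<in> borel_measurable F" and \<theta>01: "\<And>\<omega>. 0 \<le> \<theta> \<omega>" "\<And>\<omega>. \<theta> \<omega> \<le> 1"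
  shows "cond_submean M F (\<lambda>\<omega>. exp (\<theta> \<omega> * (Y \<omega> - ln c)))"
proof (rule cond_submean_mono[OF cond_submean_convex[OF subalg Y cond_submean_one _ _ \<theta> \<theta>01]])
  note [measurable] = Y measurable_from_subalg[OF subalg \<theta>]
  \<comment> \<open>Measurability is given for \<open>exp (Y \<omega>) / c\<close> only, so
    \<open>Y\<close> is recovered through the logarithm.\<close>
  have "(\<lambda>\<omega>. exp (\<theta> \<omega> * (ln (c * (exp (Y \<omega>) / c)) - ln c))) \<in> borel_measurable M" by measurable
  then show "(\<lambda>\<omega>. exp (\<theta> \<omega> * (Y \<omega> - ln c))) \<in> borel_measurable M" using c by simp
  fix \<omega>
  show "exp (\<theta> \<omega> * (Y \<omega> - ln c)) \<le> \<theta> \<omega> * (exp (Y \<omega>) / c) + (1 - \<theta> \<omega>) * 1"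
    using exp_convex_combination[OF \<theta>01, of \<omega> "Y \<omega> - ln c" 0] c by (simp add: exp_diff)
qed (use c in auto)

lemma real_cond_exp_inner_zero:
  fixes z w :: "'a \<Rightarrow> 'b::euclidean_space"
  assumes z: "integrable M z" "AE \<omega> in M. vec_cond_exp M F z \<omega> = 0"
    and w [measurable]: "w \<in> borel_measurable F" and bound: "\<And>\<omega>. norm (w \<omega>) \<le> B"
  shows "integrable M (\<lambda>\<omega>. w \<omega> \<bullet> z \<omega>)" "AE \<omega> in M. real_cond_exp M F (\<lambda>\<omega>. w \<omega> \<bullet> z \<omega>) \<omega> = 0"
proof -
  have [measurable]: "z \<in> borel_measurable M" "w \<in> borel_measurable M"
    using z(1) measurable_from_subalg[OF subalg w] by auto
  have int: "integrable M (\<lambda>\<omega>. (w \<omega> \<bullet> b) * (z \<omega> \<bullet> b))" if "b \<in> Basis" for b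
  proof (rule Bochner_Integration.integrable_bound[of M "\<lambda>\<omega>. B * norm (z \<omega>)"])
    show "AE \<omega> in M. norm ((w \<omega> \<bullet> b) * (z \<omega> \<bullet> b)) \<le> norm (B * norm (z \<omega>))"
    proof (rule AE_I2)
      fix \<omega>
      have "\<bar>w \<omega> \<bullet> b\<bar> * \<bar>z \<omega> \<bullet> b\<bar> \<le> B * norm (z \<omega>)"
        using Basis_le_norm[OF that, of "w \<omega>"] Basis_le_norm[OF that, of "z \<omega>"] bound[of \<omega>]
        by (intro mult_mono) auto
      then show "norm ((w \<omega> \<bullet> b) * (z \<omega> \<bullet> b)) \<le> norm (B * norm (z \<omega>))"
        by (simp add: abs_mult) (metis abs_ge_self abs_mult abs_norm_cancel order_trans)
    qed
  qed (use z(1) in auto)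
  have inner: "w \<omega> \<bullet> z \<omega> = (\<Sum>b\<in>Basis. (w \<omega> \<bullet> b) * (z \<omega> \<bullet> b))" for \<omega> by (rule euclidean_inner)
  show "integrable M (\<lambda>\<omega>. w \<omega> \<bullet> z \<omega>)" unfolding inner by (intro Bochner_Integration.integrable_sum int)
  have zb: "AE \<omega> in M. \<forall>b\<in>Basis. real_cond_exp M F (\<lambda>\<omega>. z \<omega> \<bullet> b) \<omega> = 0"
    using z(2)
  proof eventually_elim
    case (elim \<omega>)
    have "vec_cond_exp M F z \<omega> \<bullet> b = real_cond_exp M F (\<lambda>\<omega>. z \<omega> \<bullet> b) \<omega>" if "b \<in> Basis" for b
      unfolding vec_cond_exp_def by (rule inner_sum_left_Basis[OF that])
    with elim show ?case by simp
  qed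
  have "AE \<omega> in M. \<forall>b\<in>Basis. real_cond_exp M F (\<lambda>\<omega>. (w \<omega> \<bullet> b) * (z \<omega> \<bullet> b)) \<omega>
      = (w \<omega> \<bullet> b) * real_cond_exp M F (\<lambda>\<omega>. z \<omega> \<bullet> b) \<omega>"
    by (intro AE_finite_allI finite_Basis real_cond_exp_mult int) auto
  \<comment> \<open>The rule for sums asks for integrability at every index, so the summand is set
    to 0 outside \<open>Basis\<close>.\<close>
  moreover have "integrable M (\<lambda>\<omega>. if b \<in> Basis then (w \<omega> \<bullet> b) * (z \<omega> \<bullet> b) else 0)" for b
    by (cases "b \<in> Basis") (simp_all add: int)
  then have "AE \<omega> in M. real_cond_exp M F (\<lambda>\<omega>. \<Sum>b\<in>Basis. if b \<in> Basis then (w \<omega> \<bullet> b) * (z \<omega> \<bullet> b) else 0) \<omega>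
      = (\<Sum>b\<in>Basis. real_cond_exp M F (\<lambda>\<omega>. if b \<in> Basis then (w \<omega> \<bullet> b) * (z \<omega> \<bullet> b) else 0) \<omega>)"
    by (rule real_cond_exp_sum)
  ultimately show "AE \<omega> in M. real_cond_exp M F (\<lambda>\<omega>. w \<omega> \<bullet> z \<omega>) \<omega> = 0"
    using zb unfolding inner by eventually_elim simp
qed

text \<open>With \<open>\<kappa>\<close> the squared scale of \<open>v\<close>, Cauchy-Schwarz
  bounds the squared inner product by \<open>\<kappa>\<close> times the normalized squared noise.
  Its exponential moment costs \<open>\<kappa> * ln 3\<close>, which the compensator
  \<open>2 * \<kappa>\<close> covers. Since \<open>v\<close> may be unbounded, the linear term has
  to be truncated to stay integrable.\<close>

lemma cond_submean_exp_inner: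
  fixes z v :: "'a \<Rightarrow> 'b::euclidean_space"
  assumes z: "integrable M z" "AE \<omega> in M. vec_cond_exp M F z \<omega> = 0" and \<sigma>: "\<sigma> > 0"
    and Y: "cond_submean M F (\<lambda>\<omega>. exp ((norm (z \<omega>))\<^sup>2 / \<sigma>\<^sup>2) / 3)"
    and v [measurable]: "v \<in> borel_measurable F"
  shows "cond_submean M F (\<lambda>\<omega>. exp (v \<omega> \<bullet> z \<omega> - 2 * \<sigma>\<^sup>2 * (norm (v \<omega>))\<^sup>2))"
proof -
  have [measurable]: "z \<in> borel_measurable M" "v \<in> borel_measurable M"
    using z(1) measurable_from_subalg[OF subalg v] by auto
  define \<kappa> where "\<kappa> \<omega> = \<sigma>\<^sup>2 * (norm (v \<omega>))\<^sup>2" for \<omega>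
  have [measurable]: "\<kappa> \<in> borel_measurable F" unfolding \<kappa>_def[abs_def] by measurable
  have \<kappa>0: "0 \<le> \<kappa> \<omega>" for \<omega> by (simp add: \<kappa>_def)
  \<comment> \<open>For $\kappa \le 1$ the bound $e^u \le u + e^{u^2}$ leaves a centred term \<open>w \<bullet> z\<close> with
    bounded \<open>w\<close>; for $\kappa > 1$ Young's inequality suffices.\<close>
  define w where "w \<omega> = (if \<kappa> \<omega> \<le> 1 then exp (- 2 * \<kappa> \<omega>) *\<^sub>R v \<omega> else 0)" for \<omega>
  have w: "w \<in> borel_measurable F" unfolding w_def[abs_def] by measurable
  have bound: "norm (w \<omega>) \<le> 1 / \<sigma>" for \<omega>
  proof (cases "\<kappa> \<omega> \<le> 1")
    case True
    then have "(\<sigma> * norm (v \<omega>))\<^sup>2 \<le> 1\<^sup>2" by (simp add: \<kappa>_def power_mult_distrib)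
    then have "\<sigma> * norm (v \<omega>) \<le> 1" by (rule power2_le_imp_le) simp
    then have "norm (v \<omega>) \<le> 1 / \<sigma>" using \<sigma> by (simp add: field_simps)
    moreover have "exp (- 2 * \<kappa> \<omega>) * norm (v \<omega>) \<le> 1 * norm (v \<omega>)"
      using \<kappa>0[of \<omega>] by (intro mult_right_mono) auto
    ultimately show ?thesis using True by (simp add: w_def)
  qed (use \<sigma> in \<open>simp add: w_def\<close>)
  have Y': "cond_submean M F (\<lambda>\<omega>. exp (min (\<kappa> \<omega>) 1 * ((norm (z \<omega>))\<^sup>2 / \<sigma>\<^sup>2 - ln 3)))"
    by (rule cond_submean_exp_power[OF Y]) (use \<kappa>0 in auto)
  note ln3 = ln_3_le
  show ?thesis
  proof (rule cond_submean_add_centered[OF Y' real_cond_exp_inner_zero[OF z w bound]])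
    fix \<omega>
    define u where "u = v \<omega> \<bullet> z \<omega>"
    define Z where "Z = (norm (z \<omega>))\<^sup>2 / \<sigma>\<^sup>2"
    have Z0: "0 \<le> Z" by (simp add: Z_def)
    have "\<bar>u\<bar> \<le> norm (v \<omega>) * norm (z \<omega>)" unfolding u_def by (rule Cauchy_Schwarz_ineq2)
    then have "u\<^sup>2 \<le> (norm (v \<omega>) * norm (z \<omega>))\<^sup>2" by (metis abs_ge_zero power2_abs power_mono)
    also have "\<dots> = \<kappa> \<omega> * Z" using \<sigma> by (simp add: \<kappa>_def Z_def power_mult_distrib)
    finally have u2: "u\<^sup>2 \<le> \<kappa> \<omega> * Z" .
    have "exp (u - 2 * \<kappa> \<omega>) \<le> w \<omega> \<bullet> z \<omega> + exp (min (\<kappa> \<omega>) 1 * (Z - ln 3))"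
    proof (cases "\<kappa> \<omega> \<le> 1")
      case True
      have "exp (u - 2 * \<kappa> \<omega>) = exp (- 2 * \<kappa> \<omega>) * exp u" by (simp add: exp_add[symmetric])
      also have "\<dots> \<le> exp (- 2 * \<kappa> \<omega>) * (u + exp (u\<^sup>2))"
        by (intro mult_left_mono exp_le_add_exp_square) simp
      also have "\<dots> = w \<omega> \<bullet> z \<omega> + exp (u\<^sup>2 - 2 * \<kappa> \<omega>)"
        using True by (simp add: w_def u_def distrib_left exp_add[symmetric])
      also have "u\<^sup>2 - 2 * \<kappa> \<omega> \<le> \<kappa> \<omega> * (Z - ln 3)"
        using u2 mult_left_mono[of "ln 3" 2 "\<kappa> \<omega>"] ln3 \<kappa>0[of \<omega>] by (simp add: algebra_simps)
      finally show ?thesis using True by simp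
    next
      case False
      have "u \<le> \<bar>u\<bar>" by simp
      also have "\<bar>u\<bar> \<le> sqrt (\<kappa> \<omega> * Z)" using u2 real_le_rsqrt[of "\<bar>u\<bar>"] by simp
      also have "\<dots> \<le> (\<kappa> \<omega> + Z) / 2" by (rule arith_geo_mean_sqrt) (use \<kappa>0 Z0 in auto)
      finally have "u \<le> \<kappa> \<omega> / 2 + Z / 2" by simp
      \<comment> \<open>Now \<open>u - 2 * \<kappa> \<omega>\<close> is at most
        \<open>Z / 2 - 3 / 2 * \<kappa> \<omega>\<close>, and \<open>\<kappa> \<omega> > 1\<close>
        puts the last term below \<open>- ln 3\<close>.\<close>
      moreover have "1 < \<kappa> \<omega>" using False by simp
      ultimately have "u - 2 * \<kappa> \<omega> \<le> Z - ln 3"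
        using ln3 Z0 by linarith
      then show ?thesis using False by (simp add: w_def)
    qed
    then show "exp (v \<omega> \<bullet> z \<omega> - 2 * \<sigma>\<^sup>2 * (norm (v \<omega>))\<^sup>2)
        \<le> w \<omega> \<bullet> z \<omega> + exp (min (\<kappa> \<omega>) 1 * ((norm (z \<omega>))\<^sup>2 / \<sigma>\<^sup>2 - ln 3))"
      by (simp add: u_def Z_def \<kappa>_def mult.assoc)
  qed auto
qed

end

section \<open>Moment recursion\<close>

text \<open>\<open>d\<close> is the squared drift and \<open>\<Delta>\<close> its squared scale. The
  convexity weight 1/2 doubles the cross term, so its cost is \<open>\<alpha>\<close>; comparing
  \<open>\<alpha>\<close> with half the contraction gives the 32 in the bound on \<open>l\<close>.
  The 15/4 is 3 from the squared noise, as \<open>2 * ln 3 \<le> 3\<close>, plus 3/4 from the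
  drift.\<close>

lemma (in finite_measure_subalgebra) tracking_mgf_step:
  fixes z v :: "'a \<Rightarrow> 'b::euclidean_space" and E d :: "'a \<Rightarrow> real"
  assumes z: "integrable M z" "AE \<omega> in M. vec_cond_exp M F z \<omega> = 0" and \<sigma>: "\<sigma> > 0"
    and Y: "cond_submean M F (\<lambda>\<omega>. exp ((norm (z \<omega>))\<^sup>2 / \<sigma>\<^sup>2) / 3)"
    and v [measurable]: "v \<in> borel_measurable F"
    and d: "\<And>l. 0 \<le> l \<Longrightarrow> l * \<Delta> \<le> 1 \<Longrightarrow> cond_submean M F (\<lambda>\<omega>. exp (l * (d \<omega> - \<Delta>)))"
    and E [measurable]: "E \<in> borel_measurable M"
    and step: "\<And>\<omega>. \<omega> \<in> space M \<Longrightarrow> E \<omega> \<le> (1 - \<eta> * m) * (norm (v \<omega>))\<^sup>2 + 2 * \<eta> * (z \<omega> \<bullet> v \<omega>)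
        + 2 * \<eta>\<^sup>2 * (norm (z \<omega>))\<^sup>2 + 3 / (2 * \<eta> * m) * d \<omega>"
    and \<eta>: "\<eta> > 0" "m > 0" "\<eta> * m \<le> 1 / 2" and \<Delta>: "\<Delta> \<le> m * \<eta> ^ 3 * \<sigma>\<^sup>2 / 2"
    and l: "0 < l" "l \<le> m / (32 * \<eta> * \<sigma>\<^sup>2)"
  shows "(\<integral>\<^sup>+\<omega>. ennreal (exp (l * E \<omega>)) \<partial>M)
    \<le> ennreal (exp (l * (15 / 4 * \<eta>\<^sup>2 * \<sigma>\<^sup>2))) *
      (\<integral>\<^sup>+\<omega>. ennreal (exp (l * (1 - \<eta> * m / 2) * (norm (v \<omega>))\<^sup>2)) \<partial>M)"
proof -
  have [measurable]: "z \<in> borel_measurable M" "v \<in> borel_measurable M"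
    using z(1) measurable_from_subalg[OF subalg v] by auto
  have l': "l * (32 * \<eta> * \<sigma>\<^sup>2) \<le> m"
    using l \<eta> \<sigma> by (simp add: pos_le_divide_eq)
  define \<alpha> where "\<alpha> \<omega> = 16 * l\<^sup>2 * \<eta>\<^sup>2 * \<sigma>\<^sup>2 * (norm (v \<omega>))\<^sup>2" for \<omega>
  define \<beta> where "\<beta> = 2 * l * \<eta>\<^sup>2 * \<sigma>\<^sup>2 * ln 3"
  define \<xi> where "\<xi> = 3 / (2 * \<eta> * m) * l * \<Delta>"
  define A where "A \<omega> = 2 * \<eta> * l * (z \<omega> \<bullet> v \<omega>) - \<alpha> \<omega>" for \<omega>
  define B where "B \<omega> = 2 * \<eta>\<^sup>2 * l * (norm (z \<omega>))\<^sup>2 - \<beta>" for \<omega>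
  define C where "C \<omega> = 3 / (2 * \<eta> * m) * l * d \<omega> - \<xi>" for \<omega>
  have "cond_submean M F (\<lambda>\<omega>. exp (((4 * l * \<eta>) *\<^sub>R v \<omega>) \<bullet> z \<omega> - 2 * \<sigma>\<^sup>2 * (norm ((4 * l * \<eta>) *\<^sub>R v \<omega>))\<^sup>2))"
    by (rule cond_submean_exp_inner[OF z \<sigma> Y]) measurable
  then have A: "cond_submean M F (\<lambda>\<omega>. exp (2 * A \<omega>))"
    by (simp add: A_def \<alpha>_def power_mult_distrib algebra_simps inner_commute)
  \<comment> \<open>The convexity weight 1/4 quadruples the exponent of the squared noise; the
    result must still be a fraction of the exponent whose moment is known.\<close>
  have "8 * l * \<eta>\<^sup>2 * \<sigma>\<^sup>2 \<le> m * \<eta> / 4"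
    using mult_right_mono[OF l', of "\<eta> / 4"] \<eta> by (simp add: power2_eq_square field_simps)
  then have "8 * l * \<eta>\<^sup>2 * \<sigma>\<^sup>2 \<le> 1" using \<eta>(3) mult.commute[of m \<eta>] by linarith
  then have "cond_submean M F (\<lambda>\<omega>. exp ((8 * l * \<eta>\<^sup>2 * \<sigma>\<^sup>2) * ((norm (z \<omega>))\<^sup>2 / \<sigma>\<^sup>2 - ln 3)))"
    by (intro cond_submean_exp_power[OF Y]) (use l in auto)
  moreover have "(8 * l * \<eta>\<^sup>2 * \<sigma>\<^sup>2) * ((norm (z \<omega>))\<^sup>2 / \<sigma>\<^sup>2 - ln 3) = 4 * B \<omega>" for \<omega>
    using \<sigma> by (simp add: B_def \<beta>_def field_simps)
  ultimately have B: "cond_submean M F (\<lambda>\<omega>. exp (4 * B \<omega>))" by simp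
  \<comment> \<open>This keeps the quadrupled drift parameter \<open>6 * l / (\<eta> * m)\<close> in
    the range where \<open>d\<close> has a controlled moment.\<close>
  have \<Delta>1: "\<Delta> \<le> \<eta>\<^sup>2 * \<sigma>\<^sup>2 / 4"
  proof -
    have "\<eta> * m * (\<eta>\<^sup>2 * \<sigma>\<^sup>2 / 2) \<le> 1 / 2 * (\<eta>\<^sup>2 * \<sigma>\<^sup>2 / 2)" by (intro mult_right_mono \<eta>(3)) simp
    with \<Delta> show ?thesis by (simp add: power2_eq_square power3_eq_cube mult.commute mult.left_commute)
  qed
  have "6 * l / (\<eta> * m) * \<Delta> \<le> 6 * l / (\<eta> * m) * (\<eta>\<^sup>2 * \<sigma>\<^sup>2 / 4)"
    using l \<eta> by (intro mult_left_mono \<Delta>1) auto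
  also have "\<dots> = 6 * (l * (32 * \<eta> * \<sigma>\<^sup>2)) / (128 * m)"
    using \<eta> by (simp add: power2_eq_square)
  also have "\<dots> \<le> 6 * m / (128 * m)" using \<eta> by (intro divide_right_mono mult_left_mono l') auto
  also have "\<dots> \<le> 1" using \<eta> by simp
  finally have "cond_submean M F (\<lambda>\<omega>. exp (6 * l / (\<eta> * m) * (d \<omega> - \<Delta>)))"
    using l \<eta> by (intro d) auto
  moreover have "6 * l / (\<eta> * m) * (d \<omega> - \<Delta>) = 4 * C \<omega>" for \<omega>
    using \<eta> by (simp add: C_def \<xi>_def field_simps)
  ultimately have C: "cond_submean M F (\<lambda>\<omega>. exp (4 * C \<omega>))" by simp
  \<comment> \<open>The noise and the drift may be dependent; convexity of the exponential with weights
    $1/2, 1/4, 1/4$ takes the place of Hoelder's inequality.\<close>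
  have BC: "cond_submean M F (\<lambda>\<omega>. 1 / 2 * exp (4 * B \<omega>) + (1 - 1 / 2) * exp (4 * C \<omega>))"
    by (rule cond_submean_convex[OF subalg B C]) auto
  have ABC: "cond_submean M F (\<lambda>\<omega>. 1 / 2 * exp (2 * A \<omega>) + (1 - 1 / 2) * (1 / 2 * exp (4 * B \<omega>) + (1 - 1 / 2) * exp (4 * C \<omega>)))"
    by (rule cond_submean_convex[OF subalg A BC]) auto
  have conv: "exp (A \<omega> + B \<omega> + C \<omega>)
      \<le> 1 / 2 * exp (2 * A \<omega>) + (1 - 1 / 2) * (1 / 2 * exp (4 * B \<omega>) + (1 - 1 / 2) * exp (4 * C \<omega>))" for \<omega>
    using exp_convex_combination[of "1/2" "2 * A \<omega>" "2 * (B \<omega> + C \<omega>)"] exp_convex_combination[of "1/2" "4 * B \<omega>" "4 * C \<omega>"]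
    by (simp add: algebra_simps)
  have \<beta>: "\<beta> \<le> 3 * (l * \<eta>\<^sup>2 * \<sigma>\<^sup>2)"
    using mult_left_mono[OF ln_3_le, of "2 * l * \<eta>\<^sup>2 * \<sigma>\<^sup>2"] l by (simp add: \<beta>_def)
  have "\<xi> \<le> 3 / (2 * \<eta> * m) * l * (m * \<eta> ^ 3 * \<sigma>\<^sup>2 / 2)"
    unfolding \<xi>_def using l \<eta> by (intro mult_left_mono \<Delta>) auto
  also have "\<dots> = 3 / 4 * (l * \<eta>\<^sup>2 * \<sigma>\<^sup>2)"
    using \<eta> by (simp add: power2_eq_square power3_eq_cube)
  finally have const: "\<beta> + \<xi> \<le> l * (15 / 4 * \<eta>\<^sup>2 * \<sigma>\<^sup>2)" using \<beta> by (simp add: algebra_simps)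
  have "l * (32 * \<eta> * \<sigma>\<^sup>2) * (l * \<eta> * (norm (v \<omega>))\<^sup>2 / 2) \<le> m * (l * \<eta> * (norm (v \<omega>))\<^sup>2 / 2)" for \<omega>
    using l \<eta> by (intro mult_right_mono l') auto
  then have contr: "l * (1 - \<eta> * m) * (norm (v \<omega>))\<^sup>2 + \<alpha> \<omega> \<le> l * (1 - \<eta> * m / 2) * (norm (v \<omega>))\<^sup>2" for \<omega>
    by (simp add: \<alpha>_def power2_eq_square algebra_simps)
  have pt: "l * E \<omega> \<le> l * (15 / 4 * \<eta>\<^sup>2 * \<sigma>\<^sup>2) + l * (1 - \<eta> * m / 2) * (norm (v \<omega>))\<^sup>2 + (A \<omega> + B \<omega> + C \<omega>)"
    if "\<omega> \<in> space M" for \<omega>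
  proof -
    have "l * E \<omega> \<le> l * ((1 - \<eta> * m) * (norm (v \<omega>))\<^sup>2 + 2 * \<eta> * (z \<omega> \<bullet> v \<omega>)
        + 2 * \<eta>\<^sup>2 * (norm (z \<omega>))\<^sup>2 + 3 / (2 * \<eta> * m) * d \<omega>)"
      using l by (intro mult_left_mono step that) auto
    also have "\<dots> = l * (1 - \<eta> * m) * (norm (v \<omega>))\<^sup>2 + \<alpha> \<omega> + (\<beta> + \<xi>) + (A \<omega> + B \<omega> + C \<omega>)"
      unfolding A_def B_def C_def by (simp only: distrib_left) (simp add: algebra_simps)
    finally show ?thesis using const contr[of \<omega>] by linarith
  qed
  define W where "W \<omega> = ennreal (exp (l * (1 - \<eta> * m / 2) * (norm (v \<omega>))\<^sup>2))" for \<omega>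
  define c where "c = ennreal (exp (l * (15 / 4 * \<eta>\<^sup>2 * \<sigma>\<^sup>2)))"
  let ?X = "\<lambda>\<omega>. 1 / 2 * exp (2 * A \<omega>) + (1 - 1 / 2) * (1 / 2 * exp (4 * B \<omega>) + (1 - 1 / 2) * exp (4 * C \<omega>))"
  have W: "W \<in> borel_measurable F" unfolding W_def[abs_def] by measurable
  \<comment> \<open>The contracted exponential of the old error is measurable for \<open>F\<close>
    and becomes the test weight, even if its integral is infinite.\<close>
  have "(\<integral>\<^sup>+\<omega>. ennreal (exp (l * E \<omega>)) \<partial>M) \<le> (\<integral>\<^sup>+\<omega>. c * W \<omega> * ennreal (?X \<omega>) \<partial>M)"
  proof (rule nn_integral_mono)
    fix \<omega> assume "\<omega> \<in> space M"
    have "ennreal (exp (l * E \<omega>)) \<le> ennreal (exp (l * (15 / 4 * \<eta>\<^sup>2 * \<sigma>\<^sup>2)) *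
        exp (l * (1 - \<eta> * m / 2) * (norm (v \<omega>))\<^sup>2) * exp (A \<omega> + B \<omega> + C \<omega>))"
      using pt[OF \<open>\<omega> \<in> space M\<close>] by (intro ennreal_leI) (simp add: exp_add[symmetric])
    also have "\<dots> \<le> ennreal (exp (l * (15 / 4 * \<eta>\<^sup>2 * \<sigma>\<^sup>2)) *
        exp (l * (1 - \<eta> * m / 2) * (norm (v \<omega>))\<^sup>2) * ?X \<omega>)"
      by (intro ennreal_leI mult_left_mono conv) auto
    also have "\<dots> = c * W \<omega> * ennreal (?X \<omega>)"
      unfolding c_def W_def by (simp only: ennreal_mult' exp_ge_zero mult_nonneg_nonneg)
    finally show "ennreal (exp (l * E \<omega>)) \<le> c * W \<omega> * ennreal (?X \<omega>)" .
  qed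
  also have "\<dots> \<le> (\<integral>\<^sup>+\<omega>. c * W \<omega> \<partial>M)"
    by (rule cond_submeanD[OF ABC]) (use W in measurable)
  also have "\<dots> = c * (\<integral>\<^sup>+\<omega>. W \<omega> \<partial>M)"
    by (rule nn_integral_cmult) (rule measurable_from_subalg[OF subalg W])
  finally show ?thesis by (simp add: W_def c_def)
qed

section \<open>Iterating, rescaling and inverting exponential moments\<close>

text \<open>Going back one step shrinks the parameter by \<open>\<rho>\<close>, so it stays
  admissible. Writing the noise per step as \<open>N * (1 - \<rho>)\<close> makes the geometric sum
  telescope, with \<open>N\<close> the fixed point.\<close>

lemma mgf_contraction_iterate:
  fixes \<Phi> :: "nat \<Rightarrow> real \<Rightarrow> ennreal"
  assumes step: "\<And>t l. s \<le> t \<Longrightarrow> t < s + n \<Longrightarrow> 0 < l \<Longrightarrow> l \<le> \<Lambda> \<Longrightarrow>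
      \<Phi> (Suc t) l \<le> ennreal (exp (l * (N * (1 - \<rho>)))) * \<Phi> t (l * \<rho>)"
    and \<rho>: "0 < \<rho>" "\<rho> \<le> 1" and l: "0 < l" "l \<le> \<Lambda>"
  shows "\<Phi> (s + n) l \<le> ennreal (exp (l * (N * (1 - \<rho> ^ n)))) * \<Phi> s (l * \<rho> ^ n)"
  using step l
proof (induction n arbitrary: l)
  case (Suc n)
  have "l * \<rho> \<le> l" using Suc.prems(2) \<rho> by (intro mult_left_le) auto
  then have l\<rho>: "0 < l * \<rho>" "l * \<rho> \<le> \<Lambda>" using Suc.prems(2,3) \<rho> by (simp, linarith)
  have "\<Phi> (s + Suc n) l \<le> ennreal (exp (l * (N * (1 - \<rho>)))) * \<Phi> (s + n) (l * \<rho>)"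
    using Suc.prems by simp
  also have "\<dots> \<le> ennreal (exp (l * (N * (1 - \<rho>)))) *
      (ennreal (exp (l * \<rho> * (N * (1 - \<rho> ^ n)))) * \<Phi> s (l * \<rho> * \<rho> ^ n))"
    using Suc.prems l\<rho> by (intro mult_left_mono Suc.IH) auto
  also have "\<dots> = ennreal (exp (l * (N * (1 - \<rho> ^ Suc n)))) * \<Phi> s (l * \<rho> ^ Suc n)"
    by (simp add: mult.assoc[symmetric] ennreal_mult[symmetric] exp_add[symmetric])
      (simp add: algebra_simps)
  finally show ?case .
qed simp

text \<open>Jensen for a concave power. Centring the convex combination at the level
  \<open>c\<close> returns exactly \<open>\<theta> * c\<close>; this carries a moment bound to the
  smaller parameter wanted by the next epoch.\<close>

lemma (in prob_space) exp_moment_scale: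
  assumes [measurable]: "X \<in> borel_measurable M" and \<theta>: "0 \<le> \<theta>" "\<theta> \<le> 1"
    and le: "(\<integral>\<^sup>+\<omega>. ennreal (exp (X \<omega>)) \<partial>M) \<le> ennreal (exp c)"
  shows "(\<integral>\<^sup>+\<omega>. ennreal (exp (\<theta> * X \<omega>)) \<partial>M) \<le> ennreal (exp (\<theta> * c))"
proof -
  have pt: "exp (\<theta> * X \<omega>) \<le> \<theta> * exp (\<theta> * c - c) * exp (X \<omega>) + (1 - \<theta>) * exp (\<theta> * c)" for \<omega>
  proof -
    have "exp (\<theta> * X \<omega>) = exp (\<theta> * c) * exp (\<theta> * (X \<omega> - c) + (1 - \<theta>) * 0)"
      by (simp add: exp_add[symmetric] algebra_simps)
    also have "\<dots> \<le> exp (\<theta> * c) * (\<theta> * exp (X \<omega> - c) + (1 - \<theta>) * exp 0)"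
      by (intro mult_left_mono exp_convex_combination \<theta>) simp
    also have "\<dots> = \<theta> * exp (\<theta> * c - c) * exp (X \<omega>) + (1 - \<theta>) * exp (\<theta> * c)"
      by (simp add: exp_diff algebra_simps)
    finally show ?thesis .
  qed
  have "(\<integral>\<^sup>+\<omega>. ennreal (exp (\<theta> * X \<omega>)) \<partial>M)
      \<le> (\<integral>\<^sup>+\<omega>. ennreal (\<theta> * exp (\<theta> * c - c)) * ennreal (exp (X \<omega>)) + ennreal ((1 - \<theta>) * exp (\<theta> * c)) \<partial>M)"
    using pt \<theta> by (intro nn_integral_mono) (simp add: ennreal_mult[symmetric] ennreal_plus[symmetric] ennreal_leI del: ennreal_plus)
  also have "\<dots> = ennreal (\<theta> * exp (\<theta> * c - c)) * (\<integral>\<^sup>+\<omega>. ennreal (exp (X \<omega>)) \<partial>M) + ennreal ((1 - \<theta>) * exp (\<theta> * c))"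
    by (simp add: nn_integral_add nn_integral_cmult emeasure_space_1)
  also have "\<dots> \<le> ennreal (\<theta> * exp (\<theta> * c - c)) * ennreal (exp c) + ennreal ((1 - \<theta>) * exp (\<theta> * c))"
    by (intro add_right_mono mult_left_mono le) simp
  also have "\<dots> = ennreal (exp (\<theta> * c))"
    using \<theta> by (simp add: ennreal_mult[symmetric] ennreal_plus[symmetric] exp_diff algebra_simps del: ennreal_plus)
  finally show ?thesis .
qed

text \<open>Markov's inequality. The moment bound \<open>exp 1\<close> is the source of the
  \<open>e\<close> inside the logarithm of the tracking bound.\<close>

lemma (in prob_space) exp_moment_tail:
  assumes [measurable]: "X \<in> borel_measurable M" and l: "0 < l"
    and le: "(\<integral>\<^sup>+\<omega>. ennreal (exp (l * X \<omega>)) \<partial>M) \<le> ennreal (exp 1)"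
    and \<delta>: "0 < \<delta>" and b: "ln (exp 1 / \<delta>) / l \<le> b"
  shows "1 - \<delta> \<le> prob {\<omega> \<in> space M. X \<omega> \<le> b}"
proof -
  define A where "A = {\<omega> \<in> space M. \<not> X \<omega> \<le> b}"
  have [measurable]: "A \<in> sets M" unfolding A_def by measurable
  have pt: "indicator A \<omega> \<le> ennreal (\<delta> / exp 1) * ennreal (exp (l * X \<omega>))" for \<omega>
  proof (cases "\<omega> \<in> A")
    case True
    then have "l * b < l * X \<omega>" using l by (simp add: A_def)
    moreover have "ln (exp 1 / \<delta>) \<le> l * b" using b l by (simp add: pos_divide_le_eq mult.commute)
    ultimately have "ln (exp 1 / \<delta>) \<le> l * X \<omega>" by linarith
    then have "exp 1 / \<delta> \<le> exp (l * X \<omega>)"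
      using \<delta> by (subst (asm) exp_le_cancel_iff[symmetric]) simp
    then have "1 \<le> \<delta> / exp 1 * exp (l * X \<omega>)" using \<delta> by (simp add: field_simps)
    then show ?thesis using True \<delta> by (simp add: ennreal_mult[symmetric] ennreal_1[symmetric] ennreal_leI del: ennreal_1)
  qed simp
  have "emeasure M A = (\<integral>\<^sup>+\<omega>. indicator A \<omega> \<partial>M)" by simp
  also have "\<dots> \<le> (\<integral>\<^sup>+\<omega>. ennreal (\<delta> / exp 1) * ennreal (exp (l * X \<omega>)) \<partial>M)"
    by (intro nn_integral_mono pt)
  also have "\<dots> = ennreal (\<delta> / exp 1) * (\<integral>\<^sup>+\<omega>. ennreal (exp (l * X \<omega>)) \<partial>M)"
    by (rule nn_integral_cmult) measurable
  also have "\<dots> \<le> ennreal (\<delta> / exp 1) * ennreal (exp 1)"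
    by (intro mult_left_mono le) simp
  also have "\<dots> = ennreal \<delta>" using \<delta> by (simp add: ennreal_mult[symmetric])
  finally have "prob A \<le> \<delta>" using \<delta> by (simp add: emeasure_eq_measure)
  moreover have "prob A = 1 - prob {\<omega> \<in> space M. X \<omega> \<le> b}"
    unfolding A_def by (rule prob_neg) measurable
  ultimately show ?thesis by simp
qed

section \<open>The step-decay schedule\<close>

locale step_decay =
  fixes m L \<Delta> \<sigma> D :: real
  assumes m: "0 < m" "m \<le> L" and \<Delta>: "0 < \<Delta>" and \<sigma>: "0 < \<sigma>"
    and ratio: "\<Delta> / \<sigma> < sqrt (m / (16 * L ^ 3))"
begin

abbreviation "es \<equiv> eta_star m \<Delta> \<sigma>"
abbreviation "eta \<equiv> epoch_step m L \<Delta> \<sigma>"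
abbreviation "err \<equiv> err_star m \<Delta> \<sigma>"
abbreviation "epochs \<equiv> num_epochs m L \<Delta> \<sigma>"
abbreviation "len \<equiv> epoch_length m L \<Delta> \<sigma> D"
abbreviation "start \<equiv> epoch_start m L \<Delta> \<sigma> D"

section \<open>Step sizes and target error in terms of the limiting step\<close>

lemma L_pos: "0 < L" using m by simp

lemma eta_star_pos: "0 < es"
  using m \<Delta> \<sigma> by (simp add: eta_star_def)

lemma eta_star_cube: "es ^ 3 = 2 * \<Delta>\<^sup>2 / (m * \<sigma>\<^sup>2)"
proof -
  have "es ^ 3 = es powr (real 3)" using eta_star_pos by (simp only: powr_realpow)
  also have "\<dots> = 2 * \<Delta>\<^sup>2 / (m * \<sigma>\<^sup>2)" using m \<Delta> \<sigma> by (simp add: eta_star_def powr_powr)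
  finally show ?thesis .
qed

text \<open>The ratio hypothesis enters here: after squaring it and cubing the claim, 16 is the
  product of the 2 in \<open>eta_star\<close> and the cube of 2.\<close>

lemma eta_star_less: "es < 1 / (2 * L)"
proof (rule power_less_imp_less_base)
  have "(\<Delta> / \<sigma>)\<^sup>2 < (sqrt (m / (16 * L ^ 3)))\<^sup>2"
    using ratio \<Delta> \<sigma> by (intro power_strict_mono) auto
  also have "\<dots> = m / (16 * L ^ 3)" using m L_pos by simp
  finally have "\<Delta>\<^sup>2 / \<sigma>\<^sup>2 < m / (16 * L ^ 3)" by (simp add: power_divide)
  then have "2 / m * (\<Delta>\<^sup>2 / \<sigma>\<^sup>2) < 2 / m * (m / (16 * L ^ 3))"
    using m by (intro mult_strict_left_mono) auto
  then show "es ^ 3 < (1 / (2 * L)) ^ 3"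
    using m by (simp add: eta_star_cube power_divide power_mult_distrib)
qed (use L_pos in simp)

lemma eta_formula: "eta k = es + (1 / (2 * L) - es) / 2 ^ k"
  by (induction k) (simp_all add: field_simps)

lemma eta_star_le_eta: "es \<le> eta k"
  unfolding eta_formula using eta_star_less by simp

lemma eta_pos: "0 < eta k"
  using eta_star_le_eta eta_star_pos less_le_trans by blast

lemma eta_le: "eta k \<le> 1 / (2 * L)"
proof -
  have "(1 / (2 * L) - es) / 2 ^ k \<le> (1 / (2 * L) - es) / 1"
    using eta_star_less by (intro divide_left_mono) auto
  then show ?thesis by (simp add: eta_formula)
qed

lemma eta_L_le: "eta k * L \<le> 1 / 2"
  using eta_le[of k] L_pos by (simp add: field_simps)

lemma eta_m_le: "eta k * m \<le> 1 / 2"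
  using eta_L_le[of k] mult_left_mono[OF m(2), of "eta k"] eta_pos[of k] by linarith

text \<open>Forgetting the limit of the recursion leaves pure halving, under which the bounds on the
  epoch lengths form a geometric sequence.\<close>

lemma eta_lower: "1 / (2 * L * 2 ^ k) \<le> eta k"
proof -
  have "eta k = es * (1 - 1 / 2 ^ k) + 1 / (2 * L * 2 ^ k)" by (simp add: eta_formula field_simps)
  moreover have "0 \<le> es * (1 - 1 / 2 ^ k)" using eta_star_pos by simp
  ultimately show ?thesis by linarith
qed

text \<open>Equality at \<open>es\<close> is the defining property of \<open>eta_star\<close>, and
  no step falls below it.\<close>

lemma drift_le: "\<Delta>\<^sup>2 \<le> m * eta k ^ 3 * \<sigma>\<^sup>2 / 2"
proof -
  have "\<Delta>\<^sup>2 = m * es ^ 3 * \<sigma>\<^sup>2 / 2" using m \<sigma> by (simp add: eta_star_cube)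
  also have "\<dots> \<le> m * eta k ^ 3 * \<sigma>\<^sup>2 / 2"
    using m eta_star_pos by (intro divide_right_mono mult_right_mono mult_left_mono power_mono eta_star_le_eta) auto
  finally show ?thesis .
qed

lemma scale_eq: "(\<sigma>\<^sup>2 * m / \<Delta>\<^sup>2) powr (1/3) = 2 powr (1/3) / es"
proof -
  have "\<sigma>\<^sup>2 * m / \<Delta>\<^sup>2 = 2 / (2 * \<Delta>\<^sup>2 / (m * \<sigma>\<^sup>2))" using m by (simp add: mult.commute)
  then show ?thesis unfolding eta_star_def using m by (simp only:) (rule powr_divide; simp)
qed

lemma cube_root_2:
  "1 \<le> (2::real) powr (1/3)" "(2::real) powr (1/3) \<le> 13 / 10" "((2::real) powr (1/3)) ^ 3 = 2"
proof -
  show "1 \<le> (2::real) powr (1/3)" by (rule ge_one_powr_ge_zero) auto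
  have "((2::real) powr (1/3)) ^ 3 = ((2::real) powr (1/3)) powr (real 3)" by (subst powr_realpow) auto
  also have "\<dots> = 2" by (simp add: powr_powr)
  finally show cube: "((2::real) powr (1/3)) ^ 3 = 2" .
  also have "\<dots> \<le> (13 / 10) ^ 3" by (simp add: power3_eq_cube)
  finally show "(2::real) powr (1/3) \<le> 13 / 10" by (subst (asm) power_mono_iff) auto
qed

text \<open>Up to a cube root of 2, the target error is the noise floor at the limiting step.
  Comparing cubes avoids fractional powers.\<close>

lemma err_eq: "err = es * \<sigma>\<^sup>2 / (m * 2 powr (1/3))"
proof -
  have "err ^ 3 = err powr (real 3)"
    using m \<Delta> \<sigma> by (subst powr_realpow) (auto simp: err_star_def)
  also have "\<dots> = (\<Delta> * \<sigma>\<^sup>2 / m\<^sup>2) powr (real 2)" using m \<Delta> \<sigma> by (simp add: err_star_def powr_powr)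
  also have "\<dots> = (\<Delta> * \<sigma>\<^sup>2 / m\<^sup>2)\<^sup>2" using m \<Delta> \<sigma> by (subst powr_realpow) auto
  also have "\<dots> = es ^ 3 * (\<sigma>\<^sup>2) ^ 3 / (m ^ 3 * 2)"
  proof -
    have "(c * s / m\<^sup>2)\<^sup>2 = 2 * c\<^sup>2 / (m * s) * s ^ 3 / (m ^ 3 * 2)" if "s > 0" for c s :: real
      using that m by (simp add: power2_eq_square power3_eq_cube mult_ac)
    then show ?thesis unfolding eta_star_cube using \<sigma> by simp
  qed
  also have "\<dots> = es ^ 3 * (\<sigma>\<^sup>2) ^ 3 / (m ^ 3 * (2 powr (1/3)) ^ 3)"
    by (simp only: cube_root_2(3))
  also have "\<dots> = (es * \<sigma>\<^sup>2 / (m * 2 powr (1/3))) ^ 3"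
    by (simp add: power_mult_distrib power_divide flip: power_mult)
  finally have cube: "err ^ 3 = (es * \<sigma>\<^sup>2 / (m * 2 powr (1/3))) ^ 3" .
  show ?thesis
  proof (rule power_eq_imp_eq_base[OF cube])
    show "0 \<le> err" by (simp add: err_star_def)
    show "0 \<le> es * \<sigma>\<^sup>2 / (m * 2 powr (1/3))" using m eta_star_pos by simp
  qed simp
qed

lemma err_pos: "0 < err" using m \<Delta> \<sigma> by (simp add: err_star_def)

section \<open>Number of epochs and time horizon\<close>

lemma num_epochs_bounds:
  "1 \<le> epochs" "2 powr (1/3) / (L * es) \<le> 2 ^ (epochs - 1)" "2 ^ (epochs - 1) \<le> 2 * (2 powr (1/3) / (L * es))"
proof -
  define q where "q = 2 powr (1/3) / (L * es)"
  \<comment> \<open>This yields \<open>q \<ge> 2\<close>, so the ceiling in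
    \<open>num_epochs\<close> is nonnegative and \<open>nat\<close> truncates nothing.\<close>
  have "L * es \<le> 1 / 2" using eta_star_less L_pos by (simp add: field_simps)
  then have "1 / (1 / 2) \<le> 1 / (L * es)" using L_pos eta_star_pos by (intro divide_left_mono) auto
  also have "\<dots> \<le> q" unfolding q_def using cube_root_2 L_pos eta_star_pos by (intro divide_right_mono) auto
  finally have q: "2 \<le> q" by simp
  have epochs: "epochs = nat (1 + \<lceil>log 2 q\<rceil>)" by (simp add: num_epochs_def scale_eq q_def)
  have "0 \<le> log 2 q" using q by simp
  then have c: "0 \<le> \<lceil>log 2 q\<rceil>" by linarith
  then show "1 \<le> epochs" using epochs by linarith
  have K1: "real (epochs - 1) = of_int \<lceil>log 2 q\<rceil>" using epochs c by (simp add: nat_add_distrib)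
  have pw: "(2::real) ^ (epochs - 1) = 2 powr (real (epochs - 1))" by (simp add: powr_realpow)
  have "q = 2 powr (log 2 q)" using q by simp
  also have "\<dots> \<le> 2 ^ (epochs - 1)" unfolding pw K1 by (intro powr_mono) auto
  finally show "2 powr (1/3) / (L * es) \<le> 2 ^ (epochs - 1)" by (simp add: q_def)
  have "(2::real) ^ (epochs - 1) \<le> 2 powr (1 + log 2 q)"
    unfolding pw K1 by (intro powr_mono) (linarith, simp)
  also have "\<dots> = 2 * q" using q by (simp add: powr_add)
  finally show "2 ^ (epochs - 1) \<le> 2 * (2 powr (1/3) / (L * es))" by (simp add: q_def)
qed

lemma final_step_le: "eta (epochs - 1) \<le> 3 / 2 * es"
proof -
  have "1 / (L * es) \<le> 2 powr (1/3) / (L * es)"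
    using cube_root_2 L_pos eta_star_pos by (intro divide_right_mono) auto
  also have "\<dots> \<le> 2 ^ (epochs - 1)" by (rule num_epochs_bounds)
  finally have "1 / (2 * L) / 2 ^ (epochs - 1) \<le> es / 2" using L_pos eta_star_pos by (simp add: field_simps)
  moreover have "(1 / (2 * L) - es) / 2 ^ (epochs - 1) \<le> 1 / (2 * L) / 2 ^ (epochs - 1)"
    using eta_star_pos by (intro divide_right_mono) auto
  ultimately show ?thesis unfolding eta_formula by linarith
qed

lemma inverse_err: "\<sigma>\<^sup>2 / (m\<^sup>2 * err) = 2 powr (1/3) / (m * es)"
  using m \<sigma> eta_star_pos by (simp add: err_eq power2_eq_square)

lemma horizon_bound:
  "real (start epochs) \<le> 1000 * (L / m * log_plus (m * L * D / \<sigma>\<^sup>2) + \<sigma>\<^sup>2 / (m\<^sup>2 * err))"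
proof -
  define lp where "lp = L / m * log_plus (m * L * D / \<sigma>\<^sup>2)"
  have lp: "0 \<le> lp" using L_pos m by (simp add: lp_def log_plus_def)
  have mes: "0 < m * es" using m eta_star_pos by simp
  have "ln 12 = ln ((2::real) * (2 * 3))" by simp
  also have "\<dots> = ln 2 + (ln 2 + ln (3::real))" by (simp only: ln_mult_pos zero_less_numeral mult_pos_pos)
  finally have ln12: "ln (12::real) \<le> 7 / 2" using ln_3_le ln_2_less_1 by linarith
  have len0: "real (len 0) \<le> 4 * lp + 1"
  proof -
    have "4 * L / m * log_plus (m * L * D / \<sigma>\<^sup>2) = 4 * lp" by (simp add: lp_def)
    then show ?thesis using lp by (simp add: epoch_length_def)
  qed
  have lenS: "real (len (Suc k)) \<le> 16 * L / m * 2 ^ Suc k" for k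
  proof -
    have "real (len (Suc k)) \<le> 2 * ln 12 / (m * eta (Suc k)) + 1"
      unfolding epoch_length_def using m eta_pos[of "Suc k"] by (simp del: epoch_step.simps)
    \<comment> \<open>The 1 lost to rounding is absorbed because
      \<open>m * eta (Suc k) \<le> 1 / 2\<close>.\<close>
    also have "\<dots> \<le> 7 / (m * eta (Suc k)) + (1 / 2) / (m * eta (Suc k))"
      using ln12 m eta_pos[of "Suc k"] eta_m_le[of "Suc k"]
      by (intro add_mono divide_right_mono) (auto simp: field_simps simp del: epoch_step.simps)
    also have "\<dots> \<le> 8 / (m * eta (Suc k))"
      unfolding add_divide_distrib[symmetric] using m eta_pos[of "Suc k"]
      by (intro divide_right_mono) (auto simp del: epoch_step.simps)
    also have "\<dots> \<le> 8 / (m * (1 / (2 * L * 2 ^ Suc k)))"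
      using m L_pos eta_pos[of "Suc k"] by (intro divide_left_mono mult_left_mono eta_lower) auto
    also have "\<dots> = 16 * L / m * 2 ^ Suc k" by simp
    finally show ?thesis .
  qed
  \<comment> \<open>The length bound of the next epoch equals the geometric part
    \<open>32 * L / m * 2 ^ n\<close> reached so far, so that part doubles. In the last epoch
    \<open>L\<close> cancels against \<open>2 ^ (epochs - 1)\<close>.\<close>
  have sum: "real (start (Suc n)) \<le> 4 * lp + 1 + 32 * L / m * 2 ^ n" for n
  proof (induction n)
    case 0
    then show ?case using len0 L_pos m by (simp add: epoch_start_def add_increasing2)
  next
    case (Suc n)
    have "real (start (Suc (Suc n))) = real (start (Suc n)) + real (len (Suc n))"
      by (simp add: epoch_start_def)
    also have "\<dots> \<le> 4 * lp + 1 + 32 * L / m * 2 ^ n + 16 * L / m * 2 ^ Suc n"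
      by (intro add_mono Suc lenS)
    finally show ?case by simp
  qed
  have "real (start epochs) \<le> 4 * lp + 1 + 32 * L / m * 2 ^ (epochs - 1)"
    using sum[of "epochs - 1"] num_epochs_bounds(1) by simp
  also have "\<dots> \<le> 4 * lp + 2 powr (1/3) / (m * es) + 32 * L / m * (2 * (2 powr (1/3) / (L * es)))"
  proof (intro add_mono mult_left_mono num_epochs_bounds order_refl)
    have "m * es \<le> m * eta 0" using m by (intro mult_left_mono eta_star_le_eta) auto
    then have "m * es \<le> 1 / 2" using eta_m_le[of 0] mult.commute[of m "eta 0"] by linarith
    then have "1 \<le> 1 / (m * es)" using mes by (simp add: field_simps)
    also have "\<dots> \<le> 2 powr (1/3) / (m * es)" using mes cube_root_2 by (intro divide_right_mono) auto
    finally show "1 \<le> 2 powr (1/3) / (m * es)" .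
  qed (use m L_pos in auto)
  also have "\<dots> = 4 * lp + 65 * (2 powr (1/3) / (m * es))" using L_pos by (simp add: field_simps)
  also have "\<dots> \<le> 1000 * (lp + 2 powr (1/3) / (m * es))"
  proof -
    have "4 * a + 65 * b \<le> 1000 * (a + b)" if "0 \<le> a" "0 \<le> b" for a b :: real
      using that by simp
    moreover have "0 \<le> 2 powr (1/3) / (m * es)" using mes by simp
    ultimately show ?thesis using lp by blast
  qed
  finally show ?thesis by (simp add: lp_def inverse_err)
qed

lemma log_plus_mono: "a \<le> b \<Longrightarrow> log_plus a \<le> log_plus b"
  unfolding log_plus_def by (auto simp: max_def)

lemma log_plus_err:
  assumes "0 \<le> D"
  shows "log_plus (m * L * D / \<sigma>\<^sup>2) \<le> log_plus (D / err)"
proof (rule log_plus_mono)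
  \<comment> \<open>Through \<open>err_eq\<close> this reduces to \<open>L * es\<close> being at
    most the cube root of 2.\<close>
  have "m * L * err \<le> \<sigma>\<^sup>2"
  proof -
    have "m * L * err = (L * es) / (2 powr (1/3)) * \<sigma>\<^sup>2" using m by (simp add: err_eq)
    also have "\<dots> \<le> 1 * \<sigma>\<^sup>2"
      using eta_star_less L_pos cube_root_2 by (intro mult_right_mono) (auto simp: field_simps)
    finally show ?thesis by simp
  qed
  then have "m * L * err * D \<le> \<sigma>\<^sup>2 * D" using assms by (rule mult_right_mono)
  then show "m * L * D / \<sigma>\<^sup>2 \<le> D / err" using \<sigma> err_pos by (simp add: field_simps)
qed

section \<open>Propagating the exponential moment through the epochs\<close>

text \<open>The largest parameter that \<open>tracking_mgf_step\<close> admits at step size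
  \<open>eta k\<close>; it grows as the steps shrink, so the control sharpens.\<close>

definition lam :: "nat \<Rightarrow> real" where "lam k = m / (32 * eta k * \<sigma>\<^sup>2)"

lemma lam_pos: "0 < lam k" using m \<sigma> eta_pos[of k] by (simp add: lam_def)

lemma lam_Suc_le: "lam (Suc k) \<le> 2 * lam k"
proof -
  have "lam (Suc k) \<le> m / (32 * (eta k / 2) * \<sigma>\<^sup>2)"
    unfolding lam_def using m \<sigma> eta_pos[of k] eta_star_pos
    by (intro divide_left_mono mult_right_mono mult_left_mono) (auto intro!: mult_pos_pos)
  also have "\<dots> = 2 * lam k" using eta_pos[of k] \<sigma> by (simp add: lam_def field_simps)
  finally show ?thesis .
qed

lemma final_constant: "1 / lam (epochs - 1) \<le> 1000 * err"
proof -
  have "1 / lam (epochs - 1) = 32 * \<sigma>\<^sup>2 / m * eta (epochs - 1)" by (simp add: lam_def)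
  also have "\<dots> \<le> 32 * \<sigma>\<^sup>2 / m * (3 / 2 * es)"
    using m by (intro mult_left_mono final_step_le) auto
  also have "\<dots> = 48 * 2 powr (1/3) * err" using m by (simp add: err_eq field_simps)
  also have "\<dots> \<le> 1000 * err" using err_pos cube_root_2 by (intro mult_right_mono) auto
  finally show ?thesis .
qed

lemma contraction_power_le: "(1 - eta k * m / 2) ^ n \<le> exp (- (real n * (eta k * m / 2)))"
proof -
  have "(1 - eta k * m / 2) ^ n \<le> exp (- (eta k * m / 2)) ^ n"
    using exp_ge_add_one_self[of "- (eta k * m / 2)"] eta_m_le[of k] by (intro power_mono) auto
  then show ?thesis by (simp add: exp_of_nat_mult[symmetric])
qed

text \<open>Purely deterministic: \<open>\<Phi> t l\<close> stands for the exponential moment of the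
  squared error at time \<open>t\<close>. Starting error and accumulated noise have exponents adding
  up to 1/16 + 1/4 in epoch 0 and 1/6 + 1/4 later, both below 1.\<close>

lemma mgf_after_epochs:
  fixes \<Phi> :: "nat \<Rightarrow> real \<Rightarrow> ennreal"
  assumes step: "\<And>k t l. k < epochs \<Longrightarrow> start k \<le> t \<Longrightarrow> t < start (Suc k) \<Longrightarrow> 0 < l \<Longrightarrow> l \<le> lam k \<Longrightarrow>
      \<Phi> (Suc t) l \<le> ennreal (exp (l * (15 / 4 * (eta k)\<^sup>2 * \<sigma>\<^sup>2))) * \<Phi> t (l * (1 - eta k * m / 2))"
    and scale: "\<And>t l \<theta>. 0 \<le> \<theta> \<Longrightarrow> \<theta> \<le> 1 \<Longrightarrow> \<Phi> t l \<le> ennreal (exp 1) \<Longrightarrow> \<Phi> t (\<theta> * l) \<le> ennreal (exp \<theta>)"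
    and mono: "\<And>t l l'. l \<le> l' \<Longrightarrow> \<Phi> t l \<le> \<Phi> t l'"
    and init: "\<And>l. 0 \<le> l \<Longrightarrow> \<Phi> 0 l \<le> ennreal (exp (l * D))"
    and k: "k < epochs"
  shows "\<Phi> (start (Suc k)) (lam k) \<le> ennreal (exp 1)"
proof -
  define \<rho> where "\<rho> k = 1 - eta k * m / 2" for k
  have \<rho>: "0 < \<rho> k" "\<rho> k \<le> 1" for k using eta_m_le[of k] eta_pos[of k] m by (auto simp: \<rho>_def)
  have epoch: "\<Phi> (start (Suc k)) (lam k) \<le> ennreal (exp (1 / 4)) * \<Phi> (start k) (lam k * \<rho> k ^ len k)"
    if k: "k < epochs" for k
  proof -
    \<comment> \<open>The stationary noise level of the epoch; multiplied by \<open>lam k\<close> it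
      is 15/64, whatever the step size.\<close>
    define N where "N = 15 / 2 * eta k * \<sigma>\<^sup>2 / m"
    have N: "0 < N" using eta_pos[of k] m \<sigma> by (simp add: N_def)
    have NR: "N * (1 - \<rho> k) = 15 / 4 * (eta k)\<^sup>2 * \<sigma>\<^sup>2"
      using m by (simp add: N_def \<rho>_def power2_eq_square)
    have "\<Phi> (start k + len k) (lam k) \<le> ennreal (exp (lam k * (N * (1 - \<rho> k ^ len k)))) * \<Phi> (start k) (lam k * \<rho> k ^ len k)"
    proof (rule mgf_contraction_iterate[of "start k" "len k" "lam k"])
      fix t l assume t: "start k \<le> t" "t < start k + len k" and l: "0 < l" "l \<le> lam k"
      then have "t < start (Suc k)" by (simp add: epoch_start_def)
      from step[OF k t(1) this l]
      show "\<Phi> (Suc t) l \<le> ennreal (exp (l * (N * (1 - \<rho> k)))) * \<Phi> t (l * \<rho> k)"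
        by (simp add: NR) (simp add: \<rho>_def)
    qed (use \<rho> lam_pos in auto)
    also have "lam k * (N * (1 - \<rho> k ^ len k)) \<le> lam k * (N * 1)"
      using lam_pos[of k] N \<rho>[of k] by (intro mult_left_mono) auto
    also have "\<dots> = 15 / 64" using m \<sigma> eta_pos[of k] by (simp add: lam_def N_def)
    also have "\<dots> \<le> 1 / 4" by simp
    finally show ?thesis by (simp add: epoch_start_def ennreal_leI mult_right_mono)
  qed
  show ?thesis using k
  proof (induction k)
    case 0
    \<comment> \<open>The argument of the logarithm in the length of epoch 0. As
      \<open>eta 0 * m / 2\<close> is \<open>m / (4 * L)\<close>, that length contracts by
      \<open>exp (- log_plus s)\<close>, which brings \<open>s\<close> down to at most 1. In the
      locale \<open>D\<close> has no sign, hence the case distinctions on \<open>s\<close>.\<close>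
    define s where "s = m * L * D / \<sigma>\<^sup>2"
    have lam0: "lam 0 * D = s / 16" using L_pos by (simp add: lam_def s_def)
    have "\<rho> 0 ^ len 0 \<le> exp (- (real (len 0) * (eta 0 * m / 2)))"
      unfolding \<rho>_def by (rule contraction_power_le)
    also have "\<dots> \<le> exp (- log_plus s)"
    proof -
      have "4 * L / m * log_plus s \<le> real (len 0)" by (simp add: epoch_length_def s_def) linarith
      then have "4 * L / m * log_plus s * (m / (4 * L)) \<le> real (len 0) * (m / (4 * L))"
        using m L_pos by (intro mult_right_mono) auto
      then show ?thesis using m L_pos by simp
    qed
    finally have pw: "\<rho> 0 ^ len 0 \<le> exp (- log_plus s)" .
    have "s * exp (- log_plus s) \<le> 1"
    proof (cases "s \<le> 0")
      case False
      then have "s * exp (- log_plus s) \<le> s * exp (- ln s)"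
        by (intro mult_left_mono) (auto simp: log_plus_def)
      also have "\<dots> = 1" using False by (simp add: exp_minus)
      finally show ?thesis .
    qed (simp add: mult_nonpos_nonneg order_trans[of _ 0])
    moreover have "\<rho> 0 ^ len 0 * s \<le> max 0 (exp (- log_plus s) * s)"
    proof (cases "s \<le> 0")
      case True
      then have "\<rho> 0 ^ len 0 * s \<le> 0" using \<rho>[of 0] by (intro mult_nonneg_nonpos) auto
      then show ?thesis by simp
    next
      case False
      then have "\<rho> 0 ^ len 0 * s \<le> exp (- log_plus s) * s" using pw by (intro mult_right_mono) auto
      then show ?thesis by simp
    qed
    ultimately have "\<rho> 0 ^ len 0 * s \<le> 1" by (simp add: mult.commute)
    moreover have "lam 0 * \<rho> 0 ^ len 0 * D = \<rho> 0 ^ len 0 * (s / 16)"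
      unfolding lam0[symmetric] by (simp only: mult_ac)
    ultimately have "lam 0 * \<rho> 0 ^ len 0 * D \<le> 1 / 16" by linarith
    then have "\<Phi> 0 (lam 0 * \<rho> 0 ^ len 0) \<le> ennreal (exp (1 / 16))"
      using \<rho>[of 0] lam_pos[of 0] by (intro order_trans[OF init] ennreal_leI) auto
    then have "\<Phi> (start (Suc 0)) (lam 0) \<le> ennreal (exp (1 / 4)) * ennreal (exp (1 / 16))"
      using epoch[OF 0] by (simp add: epoch_start_def) (meson mult_left_mono order_trans zero_le)
    also have "\<dots> \<le> ennreal (exp 1)" by (simp add: ennreal_mult[symmetric] exp_add[symmetric])
    finally show ?case .
  next
    case (Suc k)
    have "\<rho> (Suc k) ^ len (Suc k) \<le> exp (- (real (len (Suc k)) * (eta (Suc k) * m / 2)))"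
      unfolding \<rho>_def by (rule contraction_power_le)
    also have "\<dots> \<le> exp (- ln 12)"
    proof -
      have me: "0 < m * eta (Suc k)" using m eta_pos[of "Suc k"] by (simp del: epoch_step.simps)
      have "2 * ln 12 / (m * eta (Suc k)) \<le> real (len (Suc k))"
        unfolding epoch_length_def by (simp del: epoch_step.simps) linarith
      then show ?thesis using me by (simp add: pos_divide_le_eq mult.commute del: epoch_step.simps)
    qed
    finally have pw: "\<rho> (Suc k) ^ len (Suc k) \<le> 1 / 12" by (simp add: exp_minus)
    \<comment> \<open>A contraction by 12 against a doubling of the parameter leaves one
      sixth.\<close>
    have "lam (Suc k) * \<rho> (Suc k) ^ len (Suc k) \<le> (2 * lam k) * (1 / 12)"
      using \<rho>[of "Suc k"] lam_pos[of k] by (intro mult_mono lam_Suc_le pw) auto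
    then have "\<Phi> (start (Suc k)) (lam (Suc k) * \<rho> (Suc k) ^ len (Suc k)) \<le> \<Phi> (start (Suc k)) (1 / 6 * lam k)"
      by (intro mono) simp
    also have "\<dots> \<le> ennreal (exp (1 / 6))"
      by (rule scale) (use Suc in auto)
    finally have "\<Phi> (start (Suc (Suc k))) (lam (Suc k)) \<le> ennreal (exp (1 / 4)) * ennreal (exp (1 / 6))"
      using epoch[OF Suc.prems] by (meson mult_left_mono order_trans zero_le)
    also have "\<dots> \<le> ennreal (exp 1)" by (simp add: ennreal_mult[symmetric] exp_add[symmetric])
    finally show ?case .
  qed
qed

end

section \<open>Tracking error\<close>

theorem theorem31:
  fixes M :: "'w measure" and F :: "nat \<Rightarrow> 'w measure"
    and f :: "nat \<Rightarrow> 'w \<Rightarrow> 'a::euclidean_space \<Rightarrow> 'a \<Rightarrow> real"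
    and r :: "nat \<Rightarrow> 'w \<Rightarrow> 'a \<Rightarrow> ereal"
    and x xbar g z :: "nat \<Rightarrow> 'w \<Rightarrow> 'a"
    and \<mu> L \<gamma> \<mu>bar \<Delta>bar \<sigma> D :: real
    and K T :: nat
  assumes pos: "\<mu> > 0" "L > 0"
    and f: "\<And>t \<omega> y. \<omega> \<in> space M \<Longrightarrow> strongly_convex \<mu> (f t \<omega> y) \<and> smooth_with L (f t \<omega> y)"
    and r: "\<And>t \<omega>. \<omega> \<in> space M \<Longrightarrow> proper_closed_convex (r t \<omega>)"
    and \<gamma>: "ereal \<gamma> = sensitivity (space M) f" "\<gamma> < \<mu>"
    and \<mu>bar: "\<mu>bar = \<mu> - \<gamma>"
    and xbar: "\<And>t \<omega>. \<omega> \<in> space M \<Longrightarrow> is_equilibrium (f t \<omega>) (r t \<omega>) (xbar t \<omega>)"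
    and filt: "filtered_prob_space M F"
    and meas: "\<And>t. x t \<in> borel_measurable (F t)" "\<And>t. xbar t \<in> borel_measurable (F t)"
      "\<And>t. z t \<in> borel_measurable (F (Suc t))"
    and noise: "\<And>t \<omega>. \<omega> \<in> space M \<Longrightarrow> z t \<omega> = gradient (f t \<omega> (x t \<omega>)) (x t \<omega>) - g t \<omega>"
    and unbiased: "\<And>t. integrable M (z t)" "\<And>t. AE \<omega> in M. vec_cond_exp M (F t) (z t) \<omega> = 0"
    and const_pos: "\<Delta>bar > 0" "\<sigma> > 0"
    and drift: "\<And>t l. 0 \<le> l \<Longrightarrow> l \<le> 1 / \<Delta>bar\<^sup>2 \<Longrightarrow>
      AE \<omega> in M. nn_cond_exp M (F t)
          (\<lambda>\<omega>'. ennreal (exp (l * (norm (xbar t \<omega>' - xbar (Suc t) \<omega>'))\<^sup>2))) \<omega>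
        \<le> ennreal (exp (l * \<Delta>bar\<^sup>2))"
    and tail: "\<And>t \<tau>. \<tau> > 0 \<Longrightarrow>
      AE \<omega> in M. real_cond_exp M (F t) (indicator {\<omega>' \<in> space M. norm (z t \<omega>') \<ge> \<tau>}) \<omega>
        \<le> 2 * exp (- 2 * \<tau>\<^sup>2 / \<sigma>\<^sup>2)"
    and ratio: "\<Delta>bar / \<sigma> < sqrt (\<mu>bar / (16 * L ^ 3))"
    and D: "\<And>\<omega>. \<omega> \<in> space M \<Longrightarrow> D \<ge> (norm (x 0 \<omega> - xbar 0 \<omega>))\<^sup>2"
    and K: "K = num_epochs \<mu>bar L \<Delta>bar \<sigma>"
    and T: "T = epoch_start \<mu>bar L \<Delta>bar \<sigma> D K"
    and algorithm: "\<And>k t \<omega>. k < K \<Longrightarrow> \<omega> \<in> space M \<Longrightarrow>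
      t \<in> {epoch_start \<mu>bar L \<Delta>bar \<sigma> D k ..< epoch_start \<mu>bar L \<Delta>bar \<sigma> D (Suc k)} \<Longrightarrow>
      is_prox (epoch_step \<mu>bar L \<Delta>bar \<sigma> k) (r t \<omega>)
        (x t \<omega> - epoch_step \<mu>bar L \<Delta>bar \<sigma> k *\<^sub>R g t \<omega>) (x (Suc t) \<omega>)"
  shows "real T \<le> abs_const *
           (L / \<mu>bar * log_plus (\<mu>bar * L * D / \<sigma>\<^sup>2)
             + \<sigma>\<^sup>2 / (\<mu>bar\<^sup>2 * err_star \<mu>bar \<Delta>bar \<sigma>))
       \<and> L / \<mu>bar * log_plus (\<mu>bar * L * D / \<sigma>\<^sup>2)
             + \<sigma>\<^sup>2 / (\<mu>bar\<^sup>2 * err_star \<mu>bar \<Delta>bar \<sigma>)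
           \<le> L / \<mu>bar * log_plus (D / err_star \<mu>bar \<Delta>bar \<sigma>)
             + \<sigma>\<^sup>2 / (\<mu>bar\<^sup>2 * err_star \<mu>bar \<Delta>bar \<sigma>)
       \<and> (\<forall>\<delta>. 0 < \<delta> \<and> \<delta> < 1 \<longrightarrow>
           measure M {\<omega> \<in> space M. (norm (x T \<omega> - xbar T \<omega>))\<^sup>2
               \<le> abs_const * (err_star \<mu>bar \<Delta>bar \<sigma> * ln (exp 1 / \<delta>))} \<ge> 1 - \<delta>)"
proof -
  interpret prob_space M using filt by (simp add: filtered_prob_space_def)
  have sub: "subalgebra M (F t)" for t using filt by (simp add: filtered_prob_space_def)
  have fms: "finite_measure_subalgebra M (F t)" for t
    by (intro finite_measure_subalgebra.intro finite_measure_axioms finite_measure_subalgebra_axioms.intro sub)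
  \<comment> \<open>One outcome suffices to extract the deterministic relations between the
    constants.\<close>
  obtain \<omega>0 where \<omega>0: "\<omega>0 \<in> space M" using not_empty by blast
  have \<gamma>0: "0 \<le> \<gamma>" by (rule sensitivity_nonneg[OF \<gamma>(1) \<omega>0])
  have \<mu>L: "\<mu> \<le> L" using f[OF \<omega>0] strongly_convex_smooth_le by blast
  have D0: "0 \<le> D" using D[OF \<omega>0] zero_le_power2 order_trans by blast
  interpret step_decay \<mu>bar L \<Delta>bar \<sigma> D
    by unfold_locales (use \<gamma> \<gamma>0 \<mu>L \<mu>bar const_pos ratio in auto)
  have [measurable]: "x t \<in> borel_measurable M" "xbar t \<in> borel_measurable M"
      "z t \<in> borel_measurable M" for t
    using meas measurable_from_subalg[OF sub] by blast+
  define \<Phi> where "\<Phi> t l = (\<integral>\<^sup>+\<omega>. ennreal (exp (l * (norm (x t \<omega> - xbar t \<omega>))\<^sup>2)) \<partial>M)" for t l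
  have noise_mgf: "cond_submean M (F t) (\<lambda>\<omega>. exp ((norm (z t \<omega>))\<^sup>2 / \<sigma>\<^sup>2) / 3)" for t
  proof (rule finite_measure_subalgebra.cond_submean_exp_tail[OF fms])
    fix s :: real assume s: "s > 0"
    \<comment> \<open>The threshold \<open>\<sigma> * sqrt s\<close> turns the Gaussian tail of the
      norm into an exponential tail of its normalized square.\<close>
    have "{\<omega> \<in> space M. norm (z t \<omega>) \<ge> \<sigma> * sqrt s} = {\<omega> \<in> space M. s \<le> (norm (z t \<omega>))\<^sup>2 / \<sigma>\<^sup>2}"
    proof (intro Collect_cong conj_cong refl)
      fix \<omega>
      have "\<sigma> * sqrt s \<le> norm (z t \<omega>) \<longleftrightarrow> (\<sigma> * sqrt s)\<^sup>2 \<le> (norm (z t \<omega>))\<^sup>2"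
        using const_pos s by (subst power_mono_iff) auto
      also have "\<dots> \<longleftrightarrow> s \<le> (norm (z t \<omega>))\<^sup>2 / \<sigma>\<^sup>2"
        using const_pos s by (simp add: power_mult_distrib field_simps)
      finally show "\<sigma> * sqrt s \<le> norm (z t \<omega>) \<longleftrightarrow> s \<le> (norm (z t \<omega>))\<^sup>2 / \<sigma>\<^sup>2" .
    qed
    with tail[of "\<sigma> * sqrt s" t]
    show "AE \<omega> in M. real_cond_exp M (F t) (indicator {\<omega> \<in> space M. s \<le> (norm (z t \<omega>))\<^sup>2 / \<sigma>\<^sup>2}) \<omega>
        \<le> 2 * exp (- 2 * s)"
      using const_pos s by (simp add: power_mult_distrib)
  qed auto
  have drift_mgf: "cond_submean M (F t) (\<lambda>\<omega>. exp (l * ((norm (xbar t \<omega> - xbar (Suc t) \<omega>))\<^sup>2 - \<Delta>bar\<^sup>2)))"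
    if l: "0 \<le> l" "l * \<Delta>bar\<^sup>2 \<le> 1" for t l
  proof -
    have "l \<le> 1 / \<Delta>bar\<^sup>2" using l const_pos by (simp add: field_simps)
    from finite_measure_subalgebra.cond_submean_of_nn_cond_exp[OF fms _ _ _ drift[OF l(1) this, of t]]
    show ?thesis by (simp add: right_diff_distrib exp_diff)
  qed
  have step: "\<Phi> (Suc t) l \<le> ennreal (exp (l * (15 / 4 * (eta k)\<^sup>2 * \<sigma>\<^sup>2))) * \<Phi> t (l * (1 - eta k * \<mu>bar / 2))"
    if k: "k < K" and t: "start k \<le> t" "t < start (Suc k)" and l: "0 < l" "l \<le> lam k" for k t l
    unfolding \<Phi>_def
  proof (rule finite_measure_subalgebra.tracking_mgf_step[OF fms unbiased const_pos(2) noise_mgf _ drift_mgf])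
    show "(\<lambda>\<omega>. x t \<omega> - xbar t \<omega>) \<in> borel_measurable (F t)"
      using meas by (intro borel_measurable_diff)
    fix \<omega> assume \<omega>: "\<omega> \<in> space M"
    have "t \<in> {start k ..< start (Suc k)}" using t by simp
    from algorithm[OF k \<omega> this]
    have p: "is_prox (eta k) (r t \<omega>) (x t \<omega> - eta k *\<^sub>R g t \<omega>) (x (Suc t) \<omega>)" .
    show "(norm (x (Suc t) \<omega> - xbar (Suc t) \<omega>))\<^sup>2 \<le> (1 - eta k * \<mu>bar) * (norm (x t \<omega> - xbar t \<omega>))\<^sup>2
        + 2 * eta k * (z t \<omega> \<bullet> (x t \<omega> - xbar t \<omega>)) + 2 * (eta k)\<^sup>2 * (norm (z t \<omega>))\<^sup>2
        + 3 / (2 * eta k * \<mu>bar) * (norm (xbar t \<omega> - xbar (Suc t) \<omega>))\<^sup>2"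
      by (rule tracking_step[OF r[OF \<omega>] eta_pos eta_L_le \<gamma>0 \<gamma>(2) \<mu>L _ _ sensitivity_bound[OF \<gamma>(1) \<omega>]
            xbar[OF \<omega>] p noise[OF \<omega>] \<mu>bar]) (use f[OF \<omega>] in auto)
  qed (use l m eta_pos eta_m_le drift_le in \<open>auto simp: lam_def\<close>)
  \<comment> \<open>At least one epoch is run, so \<open>T\<close> is the end of epoch
    \<open>K - 1\<close>, whose parameter \<open>lam (K - 1)\<close> governs the final tail.\<close>
  have K1: "K - 1 < K" "Suc (K - 1) = K" using num_epochs_bounds(1) K by auto
  have "\<Phi> (start (Suc (K - 1))) (lam (K - 1)) \<le> ennreal (exp 1)"
  proof (rule mgf_after_epochs[where \<Phi> = \<Phi>])
    fix k t :: nat and l :: real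
    assume "k < epochs" "start k \<le> t" "t < start (Suc k)" "0 < l" "l \<le> lam k"
    then show "\<Phi> (Suc t) l \<le> ennreal (exp (l * (15 / 4 * (eta k)\<^sup>2 * \<sigma>\<^sup>2))) * \<Phi> t (l * (1 - eta k * \<mu>bar / 2))"
      by (rule step[unfolded K])
  next
    fix t :: nat and l \<theta> :: real
    assume "0 \<le> \<theta>" "\<theta> \<le> 1" "\<Phi> t l \<le> ennreal (exp 1)"
    then show "\<Phi> t (\<theta> * l) \<le> ennreal (exp \<theta>)"
      using exp_moment_scale[of "\<lambda>\<omega>. l * (norm (x t \<omega> - xbar t \<omega>))\<^sup>2" \<theta> 1]
      by (simp add: \<Phi>_def mult.assoc)
  next
    fix t :: nat and l l' :: real assume "l \<le> l'"
    then show "\<Phi> t l \<le> \<Phi> t l'"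
      unfolding \<Phi>_def by (intro nn_integral_mono ennreal_leI) (simp add: mult_right_mono)
  next
    fix l :: real assume "0 \<le> l"
    then have "\<Phi> 0 l \<le> (\<integral>\<^sup>+\<omega>. ennreal (exp (l * D)) \<partial>M)"
      unfolding \<Phi>_def by (intro nn_integral_mono ennreal_leI) (simp add: mult_left_mono D)
    then show "\<Phi> 0 l \<le> ennreal (exp (l * D))" by (simp add: emeasure_space_1)
  qed (use K1 K in auto)
  then have final: "(\<integral>\<^sup>+\<omega>. ennreal (exp (lam (K - 1) * (norm (x T \<omega> - xbar T \<omega>))\<^sup>2)) \<partial>M) \<le> ennreal (exp 1)"
    using K1 K T by (simp add: \<Phi>_def)
  have "1 - \<delta> \<le> prob {\<omega> \<in> space M. (norm (x T \<omega> - xbar T \<omega>))\<^sup>2 \<le> abs_const * (err * ln (exp 1 / \<delta>))}"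
    if \<delta>: "0 < \<delta>" "\<delta> < 1" for \<delta>
  proof (rule exp_moment_tail[OF _ lam_pos final \<delta>(1)])
    \<comment> \<open>For \<open>\<delta> < 1\<close> the logarithm is nonnegative, so the
      comparison of constants may be multiplied by it.\<close>
    have "ln (exp 1 / \<delta>) = 1 - ln \<delta>" using \<delta> by (simp add: ln_div)
    then have "0 \<le> ln (exp 1 / \<delta>)" using \<delta> by (simp add: order_trans[of _ 0])
    then have "1 / lam (K - 1) * ln (exp 1 / \<delta>) \<le> 1000 * err * ln (exp 1 / \<delta>)"
      using final_constant K by (intro mult_right_mono) auto
    then show "ln (exp 1 / \<delta>) / lam (K - 1) \<le> abs_const * (err * ln (exp 1 / \<delta>))"
      by (simp add: abs_const_def)
  qed measurable
  moreover have "real T \<le> abs_const * (L / \<mu>bar * log_plus (\<mu>bar * L * D / \<sigma>\<^sup>2) + \<sigma>\<^sup>2 / (\<mu>bar\<^sup>2 * err))"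
    using horizon_bound by (simp add: T K abs_const_def)
  moreover have "L / \<mu>bar * log_plus (\<mu>bar * L * D / \<sigma>\<^sup>2) \<le> L / \<mu>bar * log_plus (D / err)"
    using m L_pos by (intro mult_left_mono log_plus_err D0) auto
  ultimately show ?thesis by simp
qed

end
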